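(* Let $(\mathcal C,X,\tau)$ be a trivalent ribbon category over $\mathbb C$ with $\dim\mathcal C(4)\le 5$. Then there exist $v,\alpha,b,d,t\in\mathbb C$ (with $v\neq 0$) such that $$\mathrm{ev}\circ\mathrm{coev}=d,\quad m\circ\mathrm{coev}=0,\quad m\circ\delta=b\,\mathrm{id}_X,\quad H\circ\delta=t\,\delta,\quad \sigma\circ\delta=-v^{6}\,\delta,\quad \sigma\circ\mathrm{coev}=v^{12}\,\mathrm{coev},$$ with $$[5]\,b=-\alpha\,(d+\{8\}),\qquad \{2\}\,t=b-[5]\,\alpha,$$ and such that the following relation holds in $\mathrm{End}(X\otimes X)$: $$v^{-3}\,H\sigma+v\,I-v^{-1}H+\alpha\left[\sigma+v^{4}\,U+v^{-4}\,\mathbf 1\right]=0 .$$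
   Context: For an object $X$ of a ribbon category $\mathcal C$, the $n$-box space is $\mathcal C(n)=\mathrm{Hom}(X^{\otimes n},\mathbf 1_{\mathcal C})$. A trivalent ribbon category $(\mathcal C,X,\tau)$ over a commutative ring $R$ is an $R$-linear ribbon category $\mathcal C$ with a self-dual object $X$ (chosen self-duality $\mathrm{ev}:X\otimes X\to\mathbf 1_{\mathcal C}$, $\mathrm{coev}:\mathbf 1_{\mathcal C}\to X\otimes X$) such that: $\mathcal C(1)=0$; $\mathcal C(0),\mathcal C(2),\mathcal C(3)$ are free $R$-modules of rank 1 generated respectively by the empty diagram $\mathrm{id}_{\mathbf 1_{\mathcal C}}$, the strand $\mathrm{ev}$, and a "trivalent vertex" $\tau\in\mathcal C(3)$; $\mathcal C$ is generated as a ribbon category by $\tau$ (all morphisms are linear combinations of diagrams built from trivalent vertices, cups, caps and braid crossings); and the circle $d=\mathrm{ev}\circ\mathrm{coev}$ and the bigon value $b$ (with $m\circ\delta=b\,\mathrm{id}_X$, see below) are non-zero. In such a category $X$ is symmetrically self-dual and $\tau$ is rotationally invariant, so unoriented strand diagrams make sense. Diagrams as morphisms: $m=(\tau\otimes\mathrm{id}_X)(\mathrm{id}_X\otimes\mathrm{id}_X\otimes\mathrm{coev}):X\otimes X\to X$ and $\delta=(m\otimes \mathrm{id}_X)(\mathrm{id}_X\otimes\mathrm{coev}):X\to X\otimes X$ (the vertex with two legs down, resp. two legs up). In $\mathrm{End}(X\otimes X)\cong\mathcal C(4)$: $\mathbf 1$ is the identity; $U=\mathrm{coev}\circ\mathrm{ev}$;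 $I=\delta\circ m$; $H=(\mathrm{id}_X\otimes m)(\delta\otimes\mathrm{id}_X)$ (two vertical strands joined by a horizontal rung); $\sigma=c_{X,X}^{-1}$ is the negative crossing (over-strand running from bottom right to top left), where $c$ is the braiding; $H\sigma=H\circ\sigma$. Notation: $[n]=v^n-v^{-n}$ and $\{n\}=v^n+v^{-n}$. *)

theory Defs
  imports Complex_Main
begin

text \<open>
  The morphisms of a small linear category are elements of one ambient module (for instance
  the direct sum of all Hom modules), of which each Hom module is a submodule.  Every small
  linear category can be presented in this way, and the notions of span and linear
  independence of the library apply to its Hom modules.  The operations on morphisms are only
  constrained on the Hom modules.
\<close>

record ('o, 'm, 'r) lin_cat =
  hom :: "'o \<Rightarrow> 'o \<Rightarrow> 'm set"
  compose :: "'m \<Rightarrow> 'm \<Rightarrow> 'm"  (infixr \<open>\<odot>\<index>\<close> 70)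
  ident :: "'o \<Rightarrow> 'm"  (\<open>\<iota>\<index>\<close>)
  scal :: "'r \<Rightarrow> 'm \<Rightarrow> 'm"  (infixr \<open>\<star>\<index>\<close> 68)

locale linear_category = module "scal C"
  for C :: "('o, 'm::ab_group_add, 'r::comm_ring_1, 'z) lin_cat_scheme" (structure) +
  assumes hom_subspace: "module.subspace (scal C) (hom C a b)"
    and ident_hom: "\<iota> a \<in> hom C a a"
    and compose_hom: "\<lbrakk>g \<in> hom C b c; f \<in> hom C a b\<rbrakk> \<Longrightarrow> g \<odot> f \<in> hom C a c"
    and compose_assoc:
      "\<lbrakk>h \<in> hom C c d; g \<in> hom C b c; f \<in> hom C a b\<rbrakk> \<Longrightarrow> (h \<odot> g) \<odot> f = h \<odot> (g \<odot> f)"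
    and ident_left: "f \<in> hom C a b \<Longrightarrow> \<iota> b \<odot> f = f"
    and ident_right: "f \<in> hom C a b \<Longrightarrow> f \<odot> \<iota> a = f"
    and compose_add_left:
      "\<lbrakk>g \<in> hom C b c; g' \<in> hom C b c; f \<in> hom C a b\<rbrakk> \<Longrightarrow> (g + g') \<odot> f = g \<odot> f + g' \<odot> f"
    and compose_add_right:
      "\<lbrakk>g \<in> hom C b c; f \<in> hom C a b; f' \<in> hom C a b\<rbrakk> \<Longrightarrow> g \<odot> (f + f') = g \<odot> f + g \<odot> f'"
    and compose_scal_left:
      "\<lbrakk>g \<in> hom C b c; f \<in> hom C a b\<rbrakk> \<Longrightarrow> (r \<star> g) \<odot> f = r \<star> (g \<odot> f)"
    and compose_scal_right:
      "\<lbrakk>g \<in> hom C b c; f \<in> hom C a b\<rbrakk> \<Longrightarrow> g \<odot> (r \<star> f) = r \<star> (g \<odot> f)"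

definition inverse_pair ::
  "('o, 'm, 'r, 'z) lin_cat_scheme \<Rightarrow> 'o \<Rightarrow> 'o \<Rightarrow> 'm \<Rightarrow> 'm \<Rightarrow> bool" where
  "inverse_pair C a b f g \<longleftrightarrow> f \<in> hom C a b \<and> g \<in> hom C b a \<and>
     g \<odot>\<^bsub>C\<^esub> f = \<iota>\<^bsub>C\<^esub> a \<and> f \<odot>\<^bsub>C\<^esub> g = \<iota>\<^bsub>C\<^esub> b"

definition is_iso :: "('o, 'm, 'r, 'z) lin_cat_scheme \<Rightarrow> 'o \<Rightarrow> 'o \<Rightarrow> 'm \<Rightarrow> bool" where
  "is_iso C a b f \<longleftrightarrow> (\<exists>g. inverse_pair C a b f g)"

definition inverse_of :: "('o, 'm, 'r, 'z) lin_cat_scheme \<Rightarrow> 'o \<Rightarrow> 'o \<Rightarrow> 'm \<Rightarrow> 'm" where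
  "inverse_of C a b f = (THE g. inverse_pair C a b f g)"

definition hom_basis ::
  "('o, 'm::ab_group_add, 'r::comm_ring_1, 'z) lin_cat_scheme \<Rightarrow> 'o \<Rightarrow> 'o \<Rightarrow> 'm set \<Rightarrow> bool" where
  "hom_basis C a b B \<longleftrightarrow>
     B \<subseteq> hom C a b \<and> \<not> module.dependent (scal C) B \<and> module.span (scal C) B = hom C a b"

record ('o, 'm, 'r) mon_cat = "('o, 'm, 'r) lin_cat" +
  tensor_obj :: "'o \<Rightarrow> 'o \<Rightarrow> 'o"  (infixr \<open>\<boxtimes>\<index>\<close> 75)
  unit_obj :: 'o  (\<open>\<one>\<index>\<close>)
  tensor_mor :: "'m \<Rightarrow> 'm \<Rightarrow> 'm"  (infixr \<open>\<otimes>\<index>\<close> 75)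
  assoc :: "'o \<Rightarrow> 'o \<Rightarrow> 'o \<Rightarrow> 'm"
  lunit :: "'o \<Rightarrow> 'm"
  runit :: "'o \<Rightarrow> 'm"

definition assoc_inv :: "('o, 'm, 'r, 'z) mon_cat_scheme \<Rightarrow> 'o \<Rightarrow> 'o \<Rightarrow> 'o \<Rightarrow> 'm" where
  "assoc_inv C a b c =
     inverse_of C ((a \<boxtimes>\<^bsub>C\<^esub> b) \<boxtimes>\<^bsub>C\<^esub> c) (a \<boxtimes>\<^bsub>C\<^esub> (b \<boxtimes>\<^bsub>C\<^esub> c)) (assoc C a b c)"

definition lunit_inv :: "('o, 'm, 'r, 'z) mon_cat_scheme \<Rightarrow> 'o \<Rightarrow> 'm" where
  "lunit_inv C a = inverse_of C (\<one>\<^bsub>C\<^esub> \<boxtimes>\<^bsub>C\<^esub> a) a (lunit C a)"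

definition runit_inv :: "('o, 'm, 'r, 'z) mon_cat_scheme \<Rightarrow> 'o \<Rightarrow> 'm" where
  "runit_inv C a = inverse_of C (a \<boxtimes>\<^bsub>C\<^esub> \<one>\<^bsub>C\<^esub>) a (runit C a)"

locale linear_monoidal_category = linear_category C
  for C :: "('o, 'm::ab_group_add, 'r::comm_ring_1, 'z) mon_cat_scheme" (structure) +
  assumes tensor_hom:
      "\<lbrakk>f \<in> hom C a b; g \<in> hom C a' b'\<rbrakk> \<Longrightarrow> f \<otimes> g \<in> hom C (a \<boxtimes> a') (b \<boxtimes> b')"
    and tensor_ident: "\<iota> a \<otimes> \<iota> b = \<iota> (a \<boxtimes> b)"
    and tensor_compose:
      "\<lbrakk>g \<in> hom C b c; f \<in> hom C a b; g' \<in> hom C b' c'; f' \<in> hom C a' b'\<rbrakk>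
        \<Longrightarrow> (g \<odot> f) \<otimes> (g' \<odot> f') = (g \<otimes> g') \<odot> (f \<otimes> f')"
    and tensor_add_left:
      "\<lbrakk>f \<in> hom C a b; f' \<in> hom C a b; g \<in> hom C c d\<rbrakk> \<Longrightarrow> (f + f') \<otimes> g = f \<otimes> g + f' \<otimes> g"
    and tensor_add_right:
      "\<lbrakk>f \<in> hom C a b; g \<in> hom C c d; g' \<in> hom C c d\<rbrakk> \<Longrightarrow> f \<otimes> (g + g') = f \<otimes> g + f \<otimes> g'"
    and tensor_scal_left:
      "\<lbrakk>f \<in> hom C a b; g \<in> hom C c d\<rbrakk> \<Longrightarrow> (r \<star> f) \<otimes> g = r \<star> (f \<otimes> g)"
    and tensor_scal_right:
      "\<lbrakk>f \<in> hom C a b; g \<in> hom C c d\<rbrakk> \<Longrightarrow> f \<otimes> (r \<star> g) = r \<star> (f \<otimes> g)"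
    and assoc_iso: "is_iso C ((a \<boxtimes> b) \<boxtimes> c) (a \<boxtimes> (b \<boxtimes> c)) (assoc C a b c)"
    and assoc_natural:
      "\<lbrakk>f \<in> hom C a a'; g \<in> hom C b b'; h \<in> hom C c c'\<rbrakk>
        \<Longrightarrow> assoc C a' b' c' \<odot> ((f \<otimes> g) \<otimes> h) = (f \<otimes> (g \<otimes> h)) \<odot> assoc C a b c"
    and lunit_iso: "is_iso C (\<one> \<boxtimes> a) a (lunit C a)"
    and lunit_natural: "f \<in> hom C a b \<Longrightarrow> lunit C b \<odot> (\<iota> \<one> \<otimes> f) = f \<odot> lunit C a"
    and runit_iso: "is_iso C (a \<boxtimes> \<one>) a (runit C a)"
    and runit_natural: "f \<in> hom C a b \<Longrightarrow> runit C b \<odot> (f \<otimes> \<iota> \<one>) = f \<odot> runit C a"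
    and pentagon:
      "assoc C a b (c \<boxtimes> d) \<odot> assoc C (a \<boxtimes> b) c d =
        (\<iota> a \<otimes> assoc C b c d) \<odot> assoc C a (b \<boxtimes> c) d \<odot> (assoc C a b c \<otimes> \<iota> d)"
    and triangle: "(\<iota> a \<otimes> lunit C b) \<odot> assoc C a \<one> b = runit C a \<otimes> \<iota> b"

text \<open>\<open>a'\<close> is a left dual of \<open>a\<close>: the two zigzag identities hold.\<close>

definition duality ::
  "('o, 'm, 'r, 'z) mon_cat_scheme \<Rightarrow> 'o \<Rightarrow> 'o \<Rightarrow> 'm \<Rightarrow> 'm \<Rightarrow> bool" where
  "duality C a a' ev coev \<longleftrightarrow>
     ev \<in> hom C (a' \<boxtimes>\<^bsub>C\<^esub> a) \<one>\<^bsub>C\<^esub> \<and> coev \<in> hom C \<one>\<^bsub>C\<^esub> (a \<boxtimes>\<^bsub>C\<^esub> a') \<and>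
     runit C a \<odot>\<^bsub>C\<^esub> (\<iota>\<^bsub>C\<^esub> a \<otimes>\<^bsub>C\<^esub> ev) \<odot>\<^bsub>C\<^esub> assoc C a a' a \<odot>\<^bsub>C\<^esub> (coev \<otimes>\<^bsub>C\<^esub> \<iota>\<^bsub>C\<^esub> a) \<odot>\<^bsub>C\<^esub> lunit_inv C a
       = \<iota>\<^bsub>C\<^esub> a \<and>
     lunit C a' \<odot>\<^bsub>C\<^esub> (ev \<otimes>\<^bsub>C\<^esub> \<iota>\<^bsub>C\<^esub> a') \<odot>\<^bsub>C\<^esub> assoc_inv C a' a a' \<odot>\<^bsub>C\<^esub> (\<iota>\<^bsub>C\<^esub> a' \<otimes>\<^bsub>C\<^esub> coev) \<odot>\<^bsub>C\<^esub> runit_inv C a'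
       = \<iota>\<^bsub>C\<^esub> a'"

record ('o, 'm, 'r) rib_cat = "('o, 'm, 'r) mon_cat" +
  braid :: "'o \<Rightarrow> 'o \<Rightarrow> 'm"
  twist :: "'o \<Rightarrow> 'm"
  dual :: "'o \<Rightarrow> 'o"
  dual_ev :: "'o \<Rightarrow> 'm"
  dual_coev :: "'o \<Rightarrow> 'm"

locale linear_ribbon_category = linear_monoidal_category C
  for C :: "('o, 'm::ab_group_add, 'r::comm_ring_1, 'z) rib_cat_scheme" (structure) +
  assumes braid_iso: "is_iso C (a \<boxtimes> b) (b \<boxtimes> a) (braid C a b)"
    and braid_natural:
      "\<lbrakk>f \<in> hom C a a'; g \<in> hom C b b'\<rbrakk> \<Longrightarrow> braid C a' b' \<odot> (f \<otimes> g) = (g \<otimes> f) \<odot> braid C a b"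
    and hexagon:
      "assoc C b c a \<odot> braid C a (b \<boxtimes> c) \<odot> assoc C a b c =
        (\<iota> b \<otimes> braid C a c) \<odot> assoc C b a c \<odot> (braid C a b \<otimes> \<iota> c)"
    and hexagon_inv:
      "assoc_inv C c a b \<odot> braid C (a \<boxtimes> b) c \<odot> assoc_inv C a b c =
        (braid C a c \<otimes> \<iota> b) \<odot> assoc_inv C a c b \<odot> (\<iota> a \<otimes> braid C b c)"
    and twist_iso: "is_iso C a a (twist C a)"
    and twist_natural: "f \<in> hom C a b \<Longrightarrow> twist C b \<odot> f = f \<odot> twist C a"
    and twist_tensor:
      "twist C (a \<boxtimes> b) = braid C b a \<odot> braid C a b \<odot> (twist C a \<otimes> twist C b)"
    and dual_duality: "duality C a (dual C a) (dual_ev C a) (dual_coev C a)"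
    and twist_dual:
      "(twist C a \<otimes> \<iota> (dual C a)) \<odot> dual_coev C a = (\<iota> a \<otimes> twist C (dual C a)) \<odot> dual_coev C a"

fun tensor_power :: "('o, 'm, 'r, 'z) mon_cat_scheme \<Rightarrow> 'o \<Rightarrow> nat \<Rightarrow> 'o" where
  "tensor_power C X 0 = \<one>\<^bsub>C\<^esub>"
| "tensor_power C X (Suc 0) = X"
| "tensor_power C X (Suc (Suc n)) = tensor_power C X (Suc n) \<boxtimes>\<^bsub>C\<^esub> X"

definition box :: "('o, 'm, 'r, 'z) mon_cat_scheme \<Rightarrow> 'o \<Rightarrow> nat \<Rightarrow> 'm set" where
  "box C X n = hom C (tensor_power C X n) \<one>\<^bsub>C\<^esub>"

definition box_basis ::
  "('o, 'm::ab_group_add, 'r::comm_ring_1, 'z) mon_cat_scheme \<Rightarrow> 'o \<Rightarrow> nat \<Rightarrow> 'm set \<Rightarrow> bool" where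
  "box_basis C X n B \<longleftrightarrow> hom_basis C (tensor_power C X n) \<one>\<^bsub>C\<^esub> B"

text \<open>\<open>X \<otimes> X \<rightarrow> (X \<otimes> X) \<otimes> \<one> \<rightarrow> (X \<otimes> X) \<otimes> (X \<otimes> X) \<rightarrow> ((X \<otimes> X) \<otimes> X) \<otimes> X \<rightarrow> \<one> \<otimes> X \<rightarrow> X\<close>\<close>

definition vertex_m :: "('o, 'm, 'r, 'z) mon_cat_scheme \<Rightarrow> 'o \<Rightarrow> 'm \<Rightarrow> 'm \<Rightarrow> 'm" where
  "vertex_m C X coev \<tau> =
     lunit C X \<odot>\<^bsub>C\<^esub> (\<tau> \<otimes>\<^bsub>C\<^esub> \<iota>\<^bsub>C\<^esub> X) \<odot>\<^bsub>C\<^esub> assoc_inv C (X \<boxtimes>\<^bsub>C\<^esub> X) X X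
       \<odot>\<^bsub>C\<^esub> ((\<iota>\<^bsub>C\<^esub> X \<otimes>\<^bsub>C\<^esub> \<iota>\<^bsub>C\<^esub> X) \<otimes>\<^bsub>C\<^esub> coev) \<odot>\<^bsub>C\<^esub> runit_inv C (X \<boxtimes>\<^bsub>C\<^esub> X)"

definition vertex_delta :: "('o, 'm, 'r, 'z) mon_cat_scheme \<Rightarrow> 'o \<Rightarrow> 'm \<Rightarrow> 'm \<Rightarrow> 'm" where
  "vertex_delta C X coev \<tau> =
     (vertex_m C X coev \<tau> \<otimes>\<^bsub>C\<^esub> \<iota>\<^bsub>C\<^esub> X) \<odot>\<^bsub>C\<^esub> assoc_inv C X X X
       \<odot>\<^bsub>C\<^esub> (\<iota>\<^bsub>C\<^esub> X \<otimes>\<^bsub>C\<^esub> coev) \<odot>\<^bsub>C\<^esub> runit_inv C X"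

definition diagram_U :: "('o, 'm, 'r, 'z) mon_cat_scheme \<Rightarrow> 'm \<Rightarrow> 'm \<Rightarrow> 'm" where
  "diagram_U C ev coev = coev \<odot>\<^bsub>C\<^esub> ev"

definition diagram_I :: "('o, 'm, 'r, 'z) mon_cat_scheme \<Rightarrow> 'o \<Rightarrow> 'm \<Rightarrow> 'm \<Rightarrow> 'm" where
  "diagram_I C X coev \<tau> = vertex_delta C X coev \<tau> \<odot>\<^bsub>C\<^esub> vertex_m C X coev \<tau>"

definition diagram_H :: "('o, 'm, 'r, 'z) mon_cat_scheme \<Rightarrow> 'o \<Rightarrow> 'm \<Rightarrow> 'm \<Rightarrow> 'm" where
  "diagram_H C X coev \<tau> =
     (\<iota>\<^bsub>C\<^esub> X \<otimes>\<^bsub>C\<^esub> vertex_m C X coev \<tau>) \<odot>\<^bsub>C\<^esub> assoc C X X X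
       \<odot>\<^bsub>C\<^esub> (vertex_delta C X coev \<tau> \<otimes>\<^bsub>C\<^esub> \<iota>\<^bsub>C\<^esub> X)"

definition neg_crossing :: "('o, 'm, 'r, 'z) rib_cat_scheme \<Rightarrow> 'o \<Rightarrow> 'm" where
  "neg_crossing C X = inverse_of C (X \<boxtimes>\<^bsub>C\<^esub> X) (X \<boxtimes>\<^bsub>C\<^esub> X) (braid C X X)"

inductive tensor_word :: "('o, 'm, 'r, 'z) mon_cat_scheme \<Rightarrow> 'o \<Rightarrow> 'o \<Rightarrow> bool" for C X where
  word_unit: "tensor_word C X \<one>\<^bsub>C\<^esub>"
| word_gen: "tensor_word C X X"
| word_tensor: "\<lbrakk>tensor_word C X a; tensor_word C X b\<rbrakk> \<Longrightarrow> tensor_word C X (a \<boxtimes>\<^bsub>C\<^esub> b)"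

text \<open>
  \<open>diagram C X ev coev \<tau> a b f\<close>: the morphism \<open>f : a \<rightarrow> b\<close> is a diagram built from trivalent
  vertices, cups, caps and crossings.  The constraints of the monoidal structure are included
  since the category is not assumed to be strict.
\<close>

inductive diagram ::
  "('o, 'm, 'r, 'z) rib_cat_scheme \<Rightarrow> 'o \<Rightarrow> 'm \<Rightarrow> 'm \<Rightarrow> 'm \<Rightarrow> 'o \<Rightarrow> 'o \<Rightarrow> 'm \<Rightarrow> bool"
  for C X ev coev \<tau> where
  diagram_ident: "tensor_word C X a \<Longrightarrow> diagram C X ev coev \<tau> a a (\<iota>\<^bsub>C\<^esub> a)"
| diagram_assoc: "\<lbrakk>tensor_word C X a; tensor_word C X b; tensor_word C X c\<rbrakk> \<Longrightarrow>
    diagram C X ev coev \<tau> ((a \<boxtimes>\<^bsub>C\<^esub> b) \<boxtimes>\<^bsub>C\<^esub> c) (a \<boxtimes>\<^bsub>C\<^esub> (b \<boxtimes>\<^bsub>C\<^esub> c)) (assoc C a b c)"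
| diagram_assoc_inv: "\<lbrakk>tensor_word C X a; tensor_word C X b; tensor_word C X c\<rbrakk> \<Longrightarrow>
    diagram C X ev coev \<tau> (a \<boxtimes>\<^bsub>C\<^esub> (b \<boxtimes>\<^bsub>C\<^esub> c)) ((a \<boxtimes>\<^bsub>C\<^esub> b) \<boxtimes>\<^bsub>C\<^esub> c) (assoc_inv C a b c)"
| diagram_lunit: "tensor_word C X a \<Longrightarrow>
    diagram C X ev coev \<tau> (\<one>\<^bsub>C\<^esub> \<boxtimes>\<^bsub>C\<^esub> a) a (lunit C a)"
| diagram_lunit_inv: "tensor_word C X a \<Longrightarrow>
    diagram C X ev coev \<tau> a (\<one>\<^bsub>C\<^esub> \<boxtimes>\<^bsub>C\<^esub> a) (lunit_inv C a)"
| diagram_runit: "tensor_word C X a \<Longrightarrow>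
    diagram C X ev coev \<tau> (a \<boxtimes>\<^bsub>C\<^esub> \<one>\<^bsub>C\<^esub>) a (runit C a)"
| diagram_runit_inv: "tensor_word C X a \<Longrightarrow>
    diagram C X ev coev \<tau> a (a \<boxtimes>\<^bsub>C\<^esub> \<one>\<^bsub>C\<^esub>) (runit_inv C a)"
| diagram_ev: "diagram C X ev coev \<tau> (X \<boxtimes>\<^bsub>C\<^esub> X) \<one>\<^bsub>C\<^esub> ev"
| diagram_coev: "diagram C X ev coev \<tau> \<one>\<^bsub>C\<^esub> (X \<boxtimes>\<^bsub>C\<^esub> X) coev"
| diagram_crossing: "diagram C X ev coev \<tau> (X \<boxtimes>\<^bsub>C\<^esub> X) (X \<boxtimes>\<^bsub>C\<^esub> X) (braid C X X)"
| diagram_neg_crossing: "diagram C X ev coev \<tau> (X \<boxtimes>\<^bsub>C\<^esub> X) (X \<boxtimes>\<^bsub>C\<^esub> X) (neg_crossing C X)"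
| diagram_vertex: "diagram C X ev coev \<tau> ((X \<boxtimes>\<^bsub>C\<^esub> X) \<boxtimes>\<^bsub>C\<^esub> X) \<one>\<^bsub>C\<^esub> \<tau>"
| diagram_compose: "\<lbrakk>diagram C X ev coev \<tau> b c g; diagram C X ev coev \<tau> a b f\<rbrakk> \<Longrightarrow>
    diagram C X ev coev \<tau> a c (g \<odot>\<^bsub>C\<^esub> f)"
| diagram_tensor: "\<lbrakk>diagram C X ev coev \<tau> a b f; diagram C X ev coev \<tau> a' b' g\<rbrakk> \<Longrightarrow>
    diagram C X ev coev \<tau> (a \<boxtimes>\<^bsub>C\<^esub> a') (b \<boxtimes>\<^bsub>C\<^esub> b') (f \<otimes>\<^bsub>C\<^esub> g)"

text \<open>
  Generation is required up to isomorphism of objects, so that the notion does not depend on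
  the chosen duals and is invariant under equivalence of ribbon categories.
\<close>

locale trivalent_ribbon_category = linear_ribbon_category C
  for C :: "('o, 'm::ab_group_add, 'r::comm_ring_1, 'z) rib_cat_scheme" (structure)
    and X :: 'o and ev coev \<tau> :: 'm +
  assumes self_dual: "duality C X X ev coev"
    and box_0: "box_basis C X 0 {\<iota> \<one>}"
    and box_1: "box C X 1 = {0}"
    and box_2: "box_basis C X 2 {ev}"
    and box_3: "box_basis C X 3 {\<tau>}"
    and generated_obj: "\<exists>w f. tensor_word C X w \<and> is_iso C a w f"
    and generated_mor: "\<lbrakk>tensor_word C X a; tensor_word C X b\<rbrakk> \<Longrightarrow>
      hom C a b = module.span (scal C) {f. diagram C X ev coev \<tau> a b f}"
    and circle_nonzero: "\<exists>d. d \<noteq> 0 \<and> ev \<odot> coev = d \<star> \<iota> \<one>"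
    and bigon_nonzero:
      "\<exists>b. b \<noteq> 0 \<and> vertex_m C X coev \<tau> \<odot> vertex_delta C X coev \<tau> = b \<star> \<iota> X"

definition vdiff :: "'a::field \<Rightarrow> int \<Rightarrow> 'a" where
  "vdiff v n = v powi n - v powi (- n)"

definition vsum :: "'a::field \<Rightarrow> int \<Rightarrow> 'a" where
  "vsum v n = v powi n + v powi (- n)"

end

theory Submission
  imports Defs
begin

text \<open>
  Let \<open>\<sigma> \<circ> \<delta> = w \<delta>\<close> and \<open>\<sigma> \<circ> coev = x coev\<close>.  Exchanging the two vertices of a theta graph, whose
  value is non-zero because \<open>b\<close> and \<open>d\<close> are, gives \<open>x = w\<^sup>2\<close>, and pulling a vertex through a curl then
  shows that the vertex is rotationally invariant.

  Rotating an endomorphism of \<open>X \<otimes> X\<close> by a quarter turn and composing with \<open>\<sigma>\<close> is, up to scalars,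
  a cyclic permutation of the pairings \<open>1\<close>, \<open>U\<close>, \<open>\<sigma>\<close> and of the trees \<open>I\<close>, \<open>H\<sigma>\<close>, \<open>H\<close>; its third power is
  \<open>x\<close> on these six diagrams.  As \<open>dim C(4) \<le> 5\<close>, they satisfy a linear relation, and it can be chosen
  to involve a tree: a relation between the pairings alone resolves the crossing, and pulling a
  vertex through the resolved crossing relates the trees.  Writing \<open>w = - v^6\<close>, the projection of
  the relation to the eigenvalue \<open>v^4\<close> is a multiple of the asserted one, and the multiple is non-zero
  for one of the three possible values of \<open>v\<^sup>2\<close>.  Closing the relation off with \<open>\<delta>\<close> and with \<open>coev\<close>
  gives the two scalar identities.
\<close>

section \<open>Coherence\<close>

text \<open>Recording source and target turns the typing conditions of the category into conditional
  rewrite rules.\<close>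

datatype ('o, 'm) arrow = Arrow (src: 'o) (tgt: 'o) (val: 'm)

section \<open>Composition, inverses and linear combinations of typed morphisms\<close>

context linear_category
begin

definition arr :: "('o, 'm) arrow \<Rightarrow> bool" where
  "arr f \<longleftrightarrow> val f \<in> hom C (src f) (tgt f)"

text \<open>The object type is a fresh type variable, so that the same operation later composes
  arrows between natural numbers, which stand for tensor powers of \<open>X\<close>.\<close>

definition cmp :: "('n, 'm) arrow \<Rightarrow> ('n, 'm) arrow \<Rightarrow> ('n, 'm) arrow"  (infixr \<open>\<cdot>\<close> 70) where
  "g \<cdot> f = Arrow (src f) (tgt g) (val g \<odot> val f)"

definition idn :: "'o \<Rightarrow> ('o, 'm) arrow" where
  "idn a = Arrow a a (\<iota> a)"

lemma cmp_simps [simp]: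
  "src (g \<cdot> f) = src f" "tgt (g \<cdot> f) = tgt g" "val (g \<cdot> f) = val g \<odot> val f"
  by (simp_all add: cmp_def)

lemma idn_simps [simp]: "src (idn a) = a" "tgt (idn a) = a" "val (idn a) = \<iota> a" "arr (idn a)"
  by (simp_all add: idn_def arr_def ident_hom)

lemma arr_cmp [simp]: "\<lbrakk>arr g; arr f; src g = tgt f\<rbrakk> \<Longrightarrow> arr (g \<cdot> f)"
  by (auto simp: arr_def intro: compose_hom)

lemma cmp_assoc [simp]:
  "\<lbrakk>arr h; arr g; arr f; src h = tgt g; src g = tgt f\<rbrakk> \<Longrightarrow> (h \<cdot> g) \<cdot> f = h \<cdot> g \<cdot> f"
  by (auto simp: arr_def cmp_def intro: compose_assoc)

lemma cmp_idn_left [simp]: "\<lbrakk>arr f; a = tgt f\<rbrakk> \<Longrightarrow> idn a \<cdot> f = f"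
  by (cases f) (auto simp: arr_def cmp_def intro: ident_left)

lemma cmp_idn_right [simp]: "\<lbrakk>arr f; a = src f\<rbrakk> \<Longrightarrow> f \<cdot> idn a = f"
  by (cases f) (auto simp: arr_def cmp_def intro: ident_right)

lemma inverse_pair_unique:
  assumes "inverse_pair C a b f g" "inverse_pair C a b f g'"
  shows "g = g'"
proof -
  have "g = \<iota> a \<odot> g" using assms by (metis inverse_pair_def ident_left)
  also have "\<dots> = (g' \<odot> f) \<odot> g" using assms by (simp add: inverse_pair_def)
  also have "\<dots> = g' \<odot> (f \<odot> g)" using assms by (meson inverse_pair_def compose_assoc)
  also have "\<dots> = g'" using assms by (metis inverse_pair_def ident_right)
  finally show ?thesis .
qed

lemma inverse_pair_inverse_of: "is_iso C a b f \<Longrightarrow> inverse_pair C a b f (inverse_of C a b f)"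
  unfolding is_iso_def inverse_of_def using inverse_pair_unique by (metis (no_types, lifting) theI)

text \<open>Composites are normalised to the right, so a pair of mutually inverse arrows at the head
  of a longer composite is not a subterm. This form removes such a pair.\<close>

lemma cmp_cancel:
  assumes "g \<cdot> f = idn (tgt h)" "arr g" "arr f" "arr h" "src g = tgt f" "src f = tgt h"
  shows "g \<cdot> f \<cdot> h = h"
proof -
  have "g \<cdot> f \<cdot> h = (g \<cdot> f) \<cdot> h" using assms(2-) by simp
  then show ?thesis using assms by simp
qed

lemma cancel_right:
  assumes "f \<cdot> i = g \<cdot> i" "i \<cdot> j = idn (tgt i)" "arr f" "arr g" "arr i" "arr j"
    "src f = tgt i" "src g = tgt i" "src i = tgt j"
  shows "f = g"
proof -
  have "(f \<cdot> i) \<cdot> j = (g \<cdot> i) \<cdot> j" using assms by simp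
  moreover have "(f \<cdot> i) \<cdot> j = f" "(g \<cdot> i) \<cdot> j = g" using assms(2-) by simp_all
  ultimately show ?thesis by simp
qed

lemma cancel_left:
  assumes "i \<cdot> f = i \<cdot> g" "j \<cdot> i = idn (src i)" "arr f" "arr g" "arr i" "arr j"
    "tgt f = src i" "tgt g = src i" "src j = tgt i"
  shows "f = g"
proof -
  have "j \<cdot> i \<cdot> f = j \<cdot> i \<cdot> g" by (simp only: assms(1))
  moreover have "j \<cdot> i \<cdot> f = f" "j \<cdot> i \<cdot> g = g" using assms(2-) by (auto intro!: cmp_cancel)
  ultimately show ?thesis by simp
qed

definition scl :: "'r \<Rightarrow> ('n, 'm) arrow \<Rightarrow> ('n, 'm) arrow"  (infixr \<open>\<star>\<star>\<close> 72) where
  "r \<star>\<star> f = Arrow (src f) (tgt f) (r \<star> val f)"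

text \<open>Source and target are taken from the first summand; the rules below ask that those of
  the second agree with them.\<close>

definition add :: "('n, 'm) arrow \<Rightarrow> ('n, 'm) arrow \<Rightarrow> ('n, 'm) arrow"  (infixl \<open>\<oplus>\<close> 65) where
  "f \<oplus> g = Arrow (src f) (tgt f) (val f + val g)"

lemma scl_simps [simp]: "src (r \<star>\<star> f) = src f" "tgt (r \<star>\<star> f) = tgt f" "val (r \<star>\<star> f) = r \<star> val f"
  by (simp_all add: scl_def)

lemma add_simps [simp]: "src (f \<oplus> g) = src f" "tgt (f \<oplus> g) = tgt f" "val (f \<oplus> g) = val f + val g"
  by (simp_all add: add_def)

lemma scl_scl [simp]: "r \<star>\<star> q \<star>\<star> f = (r * q) \<star>\<star> f"
  by (simp add: scl_def)

lemma scl_one [simp]: "1 \<star>\<star> f = f"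
  by (cases f) (simp add: scl_def)

lemma arr_scl [simp]: "arr f \<Longrightarrow> arr (r \<star>\<star> f)"
  using hom_subspace[of "src f" "tgt f"] by (simp add: arr_def subspace_scale)

lemma arr_add [simp]: "\<lbrakk>arr f; arr g; src g = src f; tgt g = tgt f\<rbrakk> \<Longrightarrow> arr (f \<oplus> g)"
  using hom_subspace[of "src f" "tgt f"] by (simp add: arr_def subspace_add)

lemma cmp_scl:
  "\<lbrakk>arr g; arr f; src g = tgt f\<rbrakk> \<Longrightarrow> (r \<star>\<star> g) \<cdot> f = r \<star>\<star> (g \<cdot> f)"
  "\<lbrakk>arr g; arr f; src g = tgt f\<rbrakk> \<Longrightarrow> g \<cdot> (r \<star>\<star> f) = r \<star>\<star> (g \<cdot> f)"
  by (auto simp: arr_def cmp_def scl_def intro: compose_scal_left compose_scal_right)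

lemma cmp_add:
  "\<lbrakk>arr g; arr h; arr f; src g = tgt f; src h = tgt f; tgt h = tgt g\<rbrakk> \<Longrightarrow> (g \<oplus> h) \<cdot> f = g \<cdot> f \<oplus> h \<cdot> f"
  "\<lbrakk>arr g; arr f; arr h; src g = tgt f; tgt h = tgt f; src h = src f\<rbrakk> \<Longrightarrow> g \<cdot> (f \<oplus> h) = g \<cdot> f \<oplus> g \<cdot> h"
  by (auto simp: arr_def cmp_def add_def intro: compose_add_left compose_add_right)

end

section \<open>The tensor product, its constraints and the coherence of the unit\<close>

context linear_monoidal_category
begin

definition tns :: "('o, 'm) arrow \<Rightarrow> ('o, 'm) arrow \<Rightarrow> ('o, 'm) arrow"  (infixr \<open>\<diamondop>\<close> 75) where
  "f \<diamondop> g = Arrow (src f \<boxtimes> src g) (tgt f \<boxtimes> tgt g) (val f \<otimes> val g)"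

lemma tns_simps [simp]:
  "src (f \<diamondop> g) = src f \<boxtimes> src g" "tgt (f \<diamondop> g) = tgt f \<boxtimes> tgt g" "val (f \<diamondop> g) = val f \<otimes> val g"
  by (simp_all add: tns_def)

lemma arr_tns [simp]: "\<lbrakk>arr f; arr g\<rbrakk> \<Longrightarrow> arr (f \<diamondop> g)"
  by (auto simp: arr_def intro: tensor_hom)

lemma tns_idn [simp]: "idn a \<diamondop> idn b = idn (a \<boxtimes> b)"
  by (simp add: tns_def idn_def tensor_ident)

lemma interchange:
  "\<lbrakk>arr g; arr f; arr g'; arr f'; src g = tgt f; src g' = tgt f'\<rbrakk>
    \<Longrightarrow> (g \<diamondop> g') \<cdot> (f \<diamondop> f') = (g \<cdot> f) \<diamondop> (g' \<cdot> f')"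
  by (simp add: tns_def cmp_def arr_def tensor_compose)

text \<open>The form of the interchange law that applies at the head of a right-nested
  composite.\<close>

lemma interchange':
  "\<lbrakk>arr g; arr f; arr g'; arr f'; src g = tgt f; src g' = tgt f'; arr h; tgt h = src f \<boxtimes> src f'\<rbrakk>
    \<Longrightarrow> (g \<diamondop> g') \<cdot> (f \<diamondop> f') \<cdot> h = ((g \<cdot> f) \<diamondop> (g' \<cdot> f')) \<cdot> h"
  by (simp add: interchange flip: cmp_assoc)

lemma tns_scl:
  "\<lbrakk>arr f; arr g\<rbrakk> \<Longrightarrow> (r \<star>\<star> f) \<diamondop> g = r \<star>\<star> (f \<diamondop> g)"
  "\<lbrakk>arr f; arr g\<rbrakk> \<Longrightarrow> f \<diamondop> (r \<star>\<star> g) = r \<star>\<star> (f \<diamondop> g)"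
  by (auto simp: arr_def tns_def scl_def intro: tensor_scal_left tensor_scal_right)

lemma tns_add:
  "\<lbrakk>arr f; arr f'; arr g; src f' = src f; tgt f' = tgt f\<rbrakk> \<Longrightarrow> (f \<oplus> f') \<diamondop> g = f \<diamondop> g \<oplus> f' \<diamondop> g"
  "\<lbrakk>arr f; arr g; arr g'; src g' = src g; tgt g' = tgt g\<rbrakk> \<Longrightarrow> f \<diamondop> (g \<oplus> g') = f \<diamondop> g \<oplus> f \<diamondop> g'"
  by (auto simp: arr_def tns_def add_def intro: tensor_add_left tensor_add_right)

definition As :: "'o \<Rightarrow> 'o \<Rightarrow> 'o \<Rightarrow> ('o, 'm) arrow" where
  "As a b c = Arrow ((a \<boxtimes> b) \<boxtimes> c) (a \<boxtimes> (b \<boxtimes> c)) (assoc C a b c)"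
definition As' :: "'o \<Rightarrow> 'o \<Rightarrow> 'o \<Rightarrow> ('o, 'm) arrow" where
  "As' a b c = Arrow (a \<boxtimes> (b \<boxtimes> c)) ((a \<boxtimes> b) \<boxtimes> c) (assoc_inv C a b c)"
definition Lu :: "'o \<Rightarrow> ('o, 'm) arrow" where "Lu a = Arrow (\<one> \<boxtimes> a) a (lunit C a)"
definition Lu' :: "'o \<Rightarrow> ('o, 'm) arrow" where "Lu' a = Arrow a (\<one> \<boxtimes> a) (lunit_inv C a)"
definition Ru :: "'o \<Rightarrow> ('o, 'm) arrow" where "Ru a = Arrow (a \<boxtimes> \<one>) a (runit C a)"
definition Ru' :: "'o \<Rightarrow> ('o, 'm) arrow" where "Ru' a = Arrow a (a \<boxtimes> \<one>) (runit_inv C a)"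

lemma As_pair: "inverse_pair C ((a \<boxtimes> b) \<boxtimes> c) (a \<boxtimes> (b \<boxtimes> c)) (assoc C a b c) (assoc_inv C a b c)"
  unfolding assoc_inv_def by (rule inverse_pair_inverse_of[OF assoc_iso])
lemma Lu_pair: "inverse_pair C (\<one> \<boxtimes> a) a (lunit C a) (lunit_inv C a)"
  unfolding lunit_inv_def by (rule inverse_pair_inverse_of[OF lunit_iso])
lemma Ru_pair: "inverse_pair C (a \<boxtimes> \<one>) a (runit C a) (runit_inv C a)"
  unfolding runit_inv_def by (rule inverse_pair_inverse_of[OF runit_iso])

lemma constraint_simps [simp]:
  "src (As a b c) = (a \<boxtimes> b) \<boxtimes> c" "tgt (As a b c) = a \<boxtimes> (b \<boxtimes> c)" "arr (As a b c)"
  "src (As' a b c) = a \<boxtimes> (b \<boxtimes> c)" "tgt (As' a b c) = (a \<boxtimes> b) \<boxtimes> c" "arr (As' a b c)"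
  "src (Lu a) = \<one> \<boxtimes> a" "tgt (Lu a) = a" "arr (Lu a)"
  "src (Lu' a) = a" "tgt (Lu' a) = \<one> \<boxtimes> a" "arr (Lu' a)"
  "src (Ru a) = a \<boxtimes> \<one>" "tgt (Ru a) = a" "arr (Ru a)"
  "src (Ru' a) = a" "tgt (Ru' a) = a \<boxtimes> \<one>" "arr (Ru' a)"
  "val (As a b c) = assoc C a b c" "val (As' a b c) = assoc_inv C a b c"
  "val (Lu a) = lunit C a" "val (Lu' a) = lunit_inv C a"
  "val (Ru a) = runit C a" "val (Ru' a) = runit_inv C a"
  using As_pair Lu_pair Ru_pair
  by (simp_all add: As_def As'_def Lu_def Lu'_def Ru_def Ru'_def arr_def inverse_pair_def)

lemma constraint_inverse [simp]:
  "As a b c \<cdot> As' a b c = idn (a \<boxtimes> (b \<boxtimes> c))" "As' a b c \<cdot> As a b c = idn ((a \<boxtimes> b) \<boxtimes> c)"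
  "Lu a \<cdot> Lu' a = idn a" "Lu' a \<cdot> Lu a = idn (\<one> \<boxtimes> a)"
  "Ru a \<cdot> Ru' a = idn a" "Ru' a \<cdot> Ru a = idn (a \<boxtimes> \<one>)"
  using As_pair[of a b c] Lu_pair[of a] Ru_pair[of a]
  by (simp_all add: cmp_def idn_def inverse_pair_def)

lemma constraint_inverse' [simp]:
  "\<lbrakk>arr f; tgt f = a \<boxtimes> (b \<boxtimes> c)\<rbrakk> \<Longrightarrow> As a b c \<cdot> As' a b c \<cdot> f = f"
  "\<lbrakk>arr f; tgt f = (a \<boxtimes> b) \<boxtimes> c\<rbrakk> \<Longrightarrow> As' a b c \<cdot> As a b c \<cdot> f = f"
  "\<lbrakk>arr f; tgt f = a\<rbrakk> \<Longrightarrow> Lu a \<cdot> Lu' a \<cdot> f = f"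
  "\<lbrakk>arr f; tgt f = \<one> \<boxtimes> a\<rbrakk> \<Longrightarrow> Lu' a \<cdot> Lu a \<cdot> f = f"
  "\<lbrakk>arr f; tgt f = a\<rbrakk> \<Longrightarrow> Ru a \<cdot> Ru' a \<cdot> f = f"
  "\<lbrakk>arr f; tgt f = a \<boxtimes> \<one>\<rbrakk> \<Longrightarrow> Ru' a \<cdot> Ru a \<cdot> f = f"
  by (simp_all add: cmp_cancel)

lemma As_natural:
  "\<lbrakk>arr f; arr g; arr h\<rbrakk> \<Longrightarrow> As (tgt f) (tgt g) (tgt h) \<cdot> ((f \<diamondop> g) \<diamondop> h) = (f \<diamondop> (g \<diamondop> h)) \<cdot> As (src f) (src g) (src h)"
  by (simp add: cmp_def arr_def assoc_natural)

lemma Lu_natural: "arr f \<Longrightarrow> Lu (tgt f) \<cdot> (idn \<one> \<diamondop> f) = f \<cdot> Lu (src f)"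
  by (simp add: cmp_def arr_def lunit_natural)

lemma Ru_natural: "arr f \<Longrightarrow> Ru (tgt f) \<cdot> (f \<diamondop> idn \<one>) = f \<cdot> Ru (src f)"
  by (simp add: cmp_def arr_def runit_natural)

lemma pentagon_arrow:
  "As a b (c \<boxtimes> d) \<cdot> As (a \<boxtimes> b) c d = (idn a \<diamondop> As b c d) \<cdot> As a (b \<boxtimes> c) d \<cdot> (As a b c \<diamondop> idn d)"
  by (simp add: cmp_def pentagon)

lemma triangle_arrow: "(idn a \<diamondop> Lu b) \<cdot> As a \<one> b = Ru a \<diamondop> idn b"
  by (simp add: cmp_def tns_def triangle)

text \<open>Tensoring with the unit is faithful: by naturality the unitor conjugates
  \<open>idn \<one> \<diamondop> f\<close> to \<open>f\<close>. Equations may therefore be checked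
  after tensoring with the unit.\<close>

lemma unit_tns_cancel:
  assumes "idn \<one> \<diamondop> f = idn \<one> \<diamondop> g" "arr f" "arr g" "src f = src g" "tgt f = tgt g"
  shows "f = g"
proof (rule cancel_right[of _ "Lu (src f)" _ "Lu' (src f)"])
  show "f \<cdot> Lu (src f) = g \<cdot> Lu (src f)" using Lu_natural[of f] Lu_natural[of g] assms by simp
qed (use assms in auto)

lemma tns_unit_cancel:
  assumes "f \<diamondop> idn \<one> = g \<diamondop> idn \<one>" "arr f" "arr g" "src f = src g" "tgt f = tgt g"
  shows "f = g"
proof (rule cancel_right[of _ "Ru (src f)" _ "Ru' (src f)"])
  show "f \<cdot> Ru (src f) = g \<cdot> Ru (src f)" using Ru_natural[of f] Ru_natural[of g] assms by simp
qed (use assms in auto)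

lemma As_natural_left:
  "\<lbrakk>arr f; arr g; arr h; a = tgt f; b = tgt g; c = tgt h; arr x; tgt x = (src f \<boxtimes> src g) \<boxtimes> src h\<rbrakk>
   \<Longrightarrow> As a b c \<cdot> ((f \<diamondop> g) \<diamondop> h) \<cdot> x = (f \<diamondop> (g \<diamondop> h)) \<cdot> As (src f) (src g) (src h) \<cdot> x"
  by (simp add: As_natural flip: cmp_assoc)

text \<open>Kelly's derivation of the unit laws for tensor products from the pentagon and the triangle.\<close>

lemma Lu_tns: "Lu (a \<boxtimes> b) \<cdot> As \<one> a b = Lu a \<diamondop> idn b"
proof (rule unit_tns_cancel)
  let ?w = "As \<one> (\<one> \<boxtimes> a) b \<cdot> (As \<one> \<one> a \<diamondop> idn b)"
  let ?w' = "(As' \<one> \<one> a \<diamondop> idn b) \<cdot> As' \<one> (\<one> \<boxtimes> a) b"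
  show "idn \<one> \<diamondop> (Lu (a \<boxtimes> b) \<cdot> As \<one> a b) = idn \<one> \<diamondop> (Lu a \<diamondop> idn b)"
  \<comment> \<open>\<open>?w\<close> is the three-arrow side of the pentagon without its last
    associator. It is invertible, so the two sides may be compared after precomposing with
    it.\<close>
  proof (rule cancel_right[of _ ?w _ ?w'])
    have "(idn \<one> \<diamondop> (Lu (a \<boxtimes> b) \<cdot> As \<one> a b)) \<cdot> ?w = (idn \<one> \<diamondop> Lu (a \<boxtimes> b)) \<cdot> (idn \<one> \<diamondop> As \<one> a b) \<cdot> ?w"
      by (simp add: interchange')
    also have "\<dots> = (idn \<one> \<diamondop> Lu (a \<boxtimes> b)) \<cdot> As \<one> \<one> (a \<boxtimes> b) \<cdot> As (\<one> \<boxtimes> \<one>) a b"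
      by (simp add: pentagon_arrow)
    also have "\<dots> = ((idn \<one> \<diamondop> Lu (a \<boxtimes> b)) \<cdot> As \<one> \<one> (a \<boxtimes> b)) \<cdot> As (\<one> \<boxtimes> \<one>) a b"
      by simp
    also have "\<dots> = (Ru \<one> \<diamondop> (idn a \<diamondop> idn b)) \<cdot> As (\<one> \<boxtimes> \<one>) a b"
      by (simp add: triangle_arrow)
    also have "\<dots> = As \<one> a b \<cdot> ((Ru \<one> \<diamondop> idn a) \<diamondop> idn b)"
      using As_natural[of "Ru \<one>" "idn a" "idn b"] by simp
    also have "\<dots> = As \<one> a b \<cdot> ((idn \<one> \<diamondop> Lu a) \<diamondop> idn b) \<cdot> (As \<one> \<one> a \<diamondop> idn b)"
      by (simp add: interchange flip: triangle_arrow)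
    also have "\<dots> = (idn \<one> \<diamondop> (Lu a \<diamondop> idn b)) \<cdot> ?w"
      by (simp add: As_natural_left)
    finally show "(idn \<one> \<diamondop> (Lu (a \<boxtimes> b) \<cdot> As \<one> a b)) \<cdot> ?w = (idn \<one> \<diamondop> (Lu a \<diamondop> idn b)) \<cdot> ?w" .
  qed (simp_all add: interchange interchange')
qed simp_all

lemma Ru_tns: "(idn a \<diamondop> Ru b) \<cdot> As a b \<one> = Ru (a \<boxtimes> b)"
proof (rule tns_unit_cancel)
  show "((idn a \<diamondop> Ru b) \<cdot> As a b \<one>) \<diamondop> idn \<one> = Ru (a \<boxtimes> b) \<diamondop> idn \<one>"
  proof (rule cancel_left[of "As a b \<one>" _ _ "As' a b \<one>"])
    have "As a b \<one> \<cdot> (((idn a \<diamondop> Ru b) \<cdot> As a b \<one>) \<diamondop> idn \<one>)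
        = As a b \<one> \<cdot> ((idn a \<diamondop> Ru b) \<diamondop> idn \<one>) \<cdot> (As a b \<one> \<diamondop> idn \<one>)"
      by (simp add: interchange)
    also have "\<dots> = (idn a \<diamondop> (Ru b \<diamondop> idn \<one>)) \<cdot> As a (b \<boxtimes> \<one>) \<one> \<cdot> (As a b \<one> \<diamondop> idn \<one>)"
      by (simp add: As_natural_left)
    also have "\<dots> = (idn a \<diamondop> (idn b \<diamondop> Lu \<one>)) \<cdot> (idn a \<diamondop> As b \<one> \<one>) \<cdot> As a (b \<boxtimes> \<one>) \<one> \<cdot> (As a b \<one> \<diamondop> idn \<one>)"
      by (simp add: interchange' flip: triangle_arrow)
    also have "\<dots> = (idn a \<diamondop> (idn b \<diamondop> Lu \<one>)) \<cdot> As a b (\<one> \<boxtimes> \<one>) \<cdot> As (a \<boxtimes> b) \<one> \<one>"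
      by (simp add: pentagon_arrow)
    also have "\<dots> = As a b \<one> \<cdot> ((idn a \<diamondop> idn b) \<diamondop> Lu \<one>) \<cdot> As (a \<boxtimes> b) \<one> \<one>"
      using As_natural_left[of "idn a" "idn b" "Lu \<one>" a b \<one> "As (a \<boxtimes> b) \<one> \<one>"] by simp
    also have "\<dots> = As a b \<one> \<cdot> (Ru (a \<boxtimes> b) \<diamondop> idn \<one>)"
      by (simp add: triangle_arrow)
    finally show "As a b \<one> \<cdot> (((idn a \<diamondop> Ru b) \<cdot> As a b \<one>) \<diamondop> idn \<one>) = As a b \<one> \<cdot> (Ru (a \<boxtimes> b) \<diamondop> idn \<one>)" .
  qed simp_all
qed simp_all

text \<open>Naturality of \<open>Lu\<close> at \<open>Lu \<one>\<close> gives \<open>Lu (\<one>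
  \<boxtimes> \<one>) = idn \<one> \<diamondop> Lu \<one>\<close>; then \<open>Lu_tns\<close> and
  the triangle express \<open>Lu \<one> \<diamondop> idn \<one>\<close> and
  \<open>Ru \<one> \<diamondop> idn \<one>\<close> by the same composite.\<close>

lemma Lu_eq_Ru: "Lu \<one> = Ru \<one>"
proof (rule tns_unit_cancel)
  have "Lu (\<one> \<boxtimes> \<one>) = idn \<one> \<diamondop> Lu \<one>"
    by (rule cancel_left[of "Lu \<one>" _ _ "Lu' \<one>"]) (use Lu_natural[of "Lu \<one>"] in simp_all)
  then show "Lu \<one> \<diamondop> idn \<one> = Ru \<one> \<diamondop> idn \<one>"
    using Lu_tns[of \<one> \<one>] triangle_arrow[of \<one> \<one>] by simp
qed simp_all

end

section \<open>The braiding and its compatibility with the unit\<close>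

context linear_ribbon_category
begin

definition Br :: "'o \<Rightarrow> 'o \<Rightarrow> ('o, 'm) arrow" where
  "Br a b = Arrow (a \<boxtimes> b) (b \<boxtimes> a) (braid C a b)"
definition Br' :: "'o \<Rightarrow> 'o \<Rightarrow> ('o, 'm) arrow" where
  "Br' a b = Arrow (b \<boxtimes> a) (a \<boxtimes> b) (inverse_of C (a \<boxtimes> b) (b \<boxtimes> a) (braid C a b))"

lemma Br_simps [simp]:
  "src (Br a b) = a \<boxtimes> b" "tgt (Br a b) = b \<boxtimes> a" "arr (Br a b)"
  "src (Br' a b) = b \<boxtimes> a" "tgt (Br' a b) = a \<boxtimes> b" "arr (Br' a b)"
  "Br a b \<cdot> Br' a b = idn (b \<boxtimes> a)" "Br' a b \<cdot> Br a b = idn (a \<boxtimes> b)"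
  "val (Br a b) = braid C a b"
  using inverse_pair_inverse_of[OF braid_iso[of a b]]
  by (simp_all add: Br_def Br'_def arr_def inverse_pair_def cmp_def idn_def)

lemma Br_natural: "\<lbrakk>arr f; arr g\<rbrakk> \<Longrightarrow> Br (tgt f) (tgt g) \<cdot> (f \<diamondop> g) = (g \<diamondop> f) \<cdot> Br (src f) (src g)"
  by (simp add: cmp_def arr_def braid_natural)

lemma hexagon_arrow:
  "As b c a \<cdot> Br a (b \<boxtimes> c) \<cdot> As a b c = (idn b \<diamondop> Br a c) \<cdot> As b a c \<cdot> (Br a b \<diamondop> idn c)"
  by (simp add: cmp_def hexagon)

lemma hexagon_inv_arrow:
  "As' c a b \<cdot> Br (a \<boxtimes> b) c \<cdot> As' a b c = (Br a c \<diamondop> idn b) \<cdot> As' a c b \<cdot> (idn a \<diamondop> Br b c)"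
  by (simp add: cmp_def hexagon_inv)

text \<open>This follows from the hexagon for \<open>a\<close>, \<open>\<one>\<close>,
  \<open>\<one>\<close>: with the unit laws and naturality, both sides become
  \<open>Br a \<one>\<close> composed with the two arrows to be compared, and
  \<open>Br a \<one>\<close> cancels.\<close>

lemma Lu_Br: "Lu a \<cdot> Br a \<one> = Ru a"
proof (rule tns_unit_cancel)
  show "(Lu a \<cdot> Br a \<one>) \<diamondop> idn \<one> = Ru a \<diamondop> idn \<one>"
  proof (rule cancel_left[of "Br a \<one>" _ _ "Br' a \<one>"])
    have "Br a \<one> \<cdot> ((Lu a \<cdot> Br a \<one>) \<diamondop> idn \<one>) = Br a \<one> \<cdot> (Lu a \<diamondop> idn \<one>) \<cdot> (Br a \<one> \<diamondop> idn \<one>)"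
      by (simp add: interchange)
    also have "\<dots> = (Br a \<one> \<cdot> Lu (a \<boxtimes> \<one>)) \<cdot> As \<one> a \<one> \<cdot> (Br a \<one> \<diamondop> idn \<one>)"
      by (simp flip: Lu_tns)
    also have "\<dots> = Lu (\<one> \<boxtimes> a) \<cdot> (idn \<one> \<diamondop> Br a \<one>) \<cdot> As \<one> a \<one> \<cdot> (Br a \<one> \<diamondop> idn \<one>)"
      using Lu_natural[of "Br a \<one>"] by (simp flip: cmp_assoc)
    also have "\<dots> = Lu (\<one> \<boxtimes> a) \<cdot> As \<one> \<one> a \<cdot> Br a (\<one> \<boxtimes> \<one>) \<cdot> As a \<one> \<one>"
      by (simp add: hexagon_arrow)
    also have "\<dots> = (Lu (\<one> \<boxtimes> a) \<cdot> As \<one> \<one> a) \<cdot> Br a (\<one> \<boxtimes> \<one>) \<cdot> As a \<one> \<one>"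
      by simp
    also have "\<dots> = ((Lu \<one> \<diamondop> idn a) \<cdot> Br a (\<one> \<boxtimes> \<one>)) \<cdot> As a \<one> \<one>"
      by (simp add: Lu_tns)
    also have "\<dots> = Br a \<one> \<cdot> (idn a \<diamondop> Lu \<one>) \<cdot> As a \<one> \<one>"
      using Br_natural[of "idn a" "Lu \<one>", symmetric] by simp
    also have "\<dots> = Br a \<one> \<cdot> (Ru a \<diamondop> idn \<one>)"
      by (simp add: triangle_arrow)
    finally show "Br a \<one> \<cdot> ((Lu a \<cdot> Br a \<one>) \<diamondop> idn \<one>) = Br a \<one> \<cdot> (Ru a \<diamondop> idn \<one>)" .
  qed simp_all
qed simp_all

text \<open>The mirror image of the preceding argument, with the second hexagon; for this the unit
  laws are first solved for the inverse associator.\<close>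

lemma Ru_Br: "Ru a \<cdot> Br \<one> a = Lu a"
proof (rule unit_tns_cancel)
  have Ru_tns': "Ru (a \<boxtimes> b) \<cdot> As' a b \<one> = idn a \<diamondop> Ru b" for a b
    by (simp flip: Ru_tns)
  have triangle': "(Ru a \<diamondop> idn b) \<cdot> As' a \<one> b = idn a \<diamondop> Lu b" for a b
    by (simp flip: triangle_arrow)
  show "idn \<one> \<diamondop> (Ru a \<cdot> Br \<one> a) = idn \<one> \<diamondop> Lu a"
  proof (rule cancel_left[of "Br \<one> a" _ _ "Br' \<one> a"])
    have "Br \<one> a \<cdot> (idn \<one> \<diamondop> (Ru a \<cdot> Br \<one> a)) = Br \<one> a \<cdot> (idn \<one> \<diamondop> Ru a) \<cdot> (idn \<one> \<diamondop> Br \<one> a)"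
      by (simp add: interchange)
    also have "\<dots> = (Br \<one> a \<cdot> Ru (\<one> \<boxtimes> a)) \<cdot> As' \<one> a \<one> \<cdot> (idn \<one> \<diamondop> Br \<one> a)"
      by (simp flip: Ru_tns')
    also have "\<dots> = Ru (a \<boxtimes> \<one>) \<cdot> (Br \<one> a \<diamondop> idn \<one>) \<cdot> As' \<one> a \<one> \<cdot> (idn \<one> \<diamondop> Br \<one> a)"
      using Ru_natural[of "Br \<one> a"] by (simp flip: cmp_assoc)
    also have "\<dots> = Ru (a \<boxtimes> \<one>) \<cdot> As' a \<one> \<one> \<cdot> Br (\<one> \<boxtimes> \<one>) a \<cdot> As' \<one> \<one> a"
      by (simp add: hexagon_inv_arrow)
    also have "\<dots> = (Ru (a \<boxtimes> \<one>) \<cdot> As' a \<one> \<one>) \<cdot> Br (\<one> \<boxtimes> \<one>) a \<cdot> As' \<one> \<one> a"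
      by simp
    also have "\<dots> = ((idn a \<diamondop> Ru \<one>) \<cdot> Br (\<one> \<boxtimes> \<one>) a) \<cdot> As' \<one> \<one> a"
      by (simp add: Ru_tns')
    also have "\<dots> = Br \<one> a \<cdot> (Ru \<one> \<diamondop> idn a) \<cdot> As' \<one> \<one> a"
      using Br_natural[of "Ru \<one>" "idn a", symmetric] by simp
    also have "\<dots> = Br \<one> a \<cdot> (idn \<one> \<diamondop> Lu a)"
      by (simp add: triangle')
    finally show "Br \<one> a \<cdot> (idn \<one> \<diamondop> (Ru a \<cdot> Br \<one> a)) = Br \<one> a \<cdot> (idn \<one> \<diamondop> Lu a)" .
  qed simp_all
qed simp_all

end

section \<open>Strictification\<close>

locale monoidal_object = linear_monoidal_category C
  for C :: "('o, 'm::ab_group_add, 'r::comm_ring_1, 'z) mon_cat_scheme" (structure) and X :: 'o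
begin

abbreviation P :: "nat \<Rightarrow> 'o" where "P n \<equiv> tensor_power C X n"

lemma P_Suc: "n > 0 \<Longrightarrow> P (Suc n) = P n \<boxtimes> X"
  by (cases n) auto

text \<open>The canonical isomorphism \<open>P n \<boxtimes> P p \<rightarrow> P (n + p)\<close>,
  with inverse \<open>nu\<close>. Powers are nested to the left and \<open>P 1\<close> is
  \<open>X\<close> without a unit factor, hence the separate cases for exponents 0 and 1.\<close>

fun mu :: "nat \<Rightarrow> nat \<Rightarrow> ('o, 'm) arrow" where
  "mu 0 p = Lu (P p)"
| "mu (Suc n) 0 = Ru (P (Suc n))"
| "mu (Suc n) (Suc 0) = idn (P (Suc (Suc n)))"
| "mu (Suc n) (Suc (Suc p)) = (mu (Suc n) (Suc p) \<diamondop> idn X) \<cdot> As' (P (Suc n)) (P (Suc p)) X"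

fun nu :: "nat \<Rightarrow> nat \<Rightarrow> ('o, 'm) arrow" where
  "nu 0 p = Lu' (P p)"
| "nu (Suc n) 0 = Ru' (P (Suc n))"
| "nu (Suc n) (Suc 0) = idn (P (Suc (Suc n)))"
| "nu (Suc n) (Suc (Suc p)) = As (P (Suc n)) (P (Suc p)) X \<cdot> (nu (Suc n) (Suc p) \<diamondop> idn X)"

lemma mu_simps [simp]: "src (mu n p) = P n \<boxtimes> P p" "tgt (mu n p) = P (n + p)" "arr (mu n p)"
  by (induction n p rule: mu.induct) (simp_all add: P_Suc)

lemma nu_simps [simp]: "tgt (nu n p) = P n \<boxtimes> P p" "src (nu n p) = P (n + p)" "arr (nu n p)"
  by (induction n p rule: nu.induct) (simp_all add: P_Suc)

lemma mu_nu [simp]: "mu n p \<cdot> nu n p = idn (P (n + p))" "nu n p \<cdot> mu n p = idn (P n \<boxtimes> P p)"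
  by (induction n p rule: nu.induct) (simp_all add: P_Suc interchange interchange')

lemma mu_nu' [simp]:
  "\<lbrakk>arr f; tgt f = P (n + p)\<rbrakk> \<Longrightarrow> mu n p \<cdot> nu n p \<cdot> f = f"
  "\<lbrakk>arr f; tgt f = P n \<boxtimes> P p\<rbrakk> \<Longrightarrow> nu n p \<cdot> mu n p \<cdot> f = f"
  by (auto intro!: cmp_cancel)

lemma mu_Suc:
  assumes "n > 0" "p > 0"
  shows "(mu n p \<diamondop> idn X) = mu n (Suc p) \<cdot> As (P n) (P p) X"
proof -
  obtain k l where "n = Suc k" "p = Suc l" using assms by (metis gr0_implies_Suc)
  then show ?thesis by simp
qed

text \<open>Induction on \<open>q\<close>, splitting off the last strand; the pentagon compares the
  two ways of doing so. Positivity makes each further power arise by tensoring with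
  \<open>X\<close>.\<close>

lemma mu_assoc_pos:
  assumes "n > 0" "p > 0" "q > 0"
  shows "mu (n + p) q \<cdot> (mu n p \<diamondop> idn (P q)) = mu n (p + q) \<cdot> (idn (P n) \<diamondop> mu p q) \<cdot> As (P n) (P p) (P q)"
  using assms(3)
proof (induction q)
  case 0
  then show ?case by simp
next
  case (Suc q)
  show ?case
  proof (cases "q = 0")
    case True
    obtain k l where "n = Suc k" "p = Suc l" using assms by (metis gr0_implies_Suc)
    then show ?thesis using True by simp
  next
    case False
    then have q: "q > 0" by simp
    have IH: "mu (n + p) q \<cdot> (mu n p \<diamondop> idn (P q)) = mu n (p + q) \<cdot> (idn (P n) \<diamondop> mu p q) \<cdot> As (P n) (P p) (P q)"
      using Suc.IH q by simp
    have PS: "P (Suc q) = P q \<boxtimes> X" "P (Suc (p + q)) = P (p + q) \<boxtimes> X" using q by (simp_all add: P_Suc)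
    let ?A = "As (P n \<boxtimes> P p) (P q) X"
    show ?thesis
    proof (rule cancel_right[of _ ?A _ "As' (P n \<boxtimes> P p) (P q) X"])
      have "(mu (n + p) (Suc q) \<cdot> (mu n p \<diamondop> idn (P (Suc q)))) \<cdot> ?A
          = mu (n + p) (Suc q) \<cdot> (mu n p \<diamondop> (idn (P q) \<diamondop> idn X)) \<cdot> ?A"
        by (simp add: PS)
      also have "\<dots> = mu (n + p) (Suc q) \<cdot> As (P (n + p)) (P q) X \<cdot> ((mu n p \<diamondop> idn (P q)) \<diamondop> idn X)"
        using As_natural[of "mu n p" "idn (P q)" "idn X"] by (simp add: PS)
      also have "\<dots> = (mu (n + p) (Suc q) \<cdot> As (P (n + p)) (P q) X) \<cdot> ((mu n p \<diamondop> idn (P q)) \<diamondop> idn X)"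
        by (simp add: PS)
      also have "\<dots> = (mu (n + p) q \<diamondop> idn X) \<cdot> ((mu n p \<diamondop> idn (P q)) \<diamondop> idn X)"
        using q assms by (simp add: mu_Suc)
      also have "\<dots> = (mu n (p + q) \<diamondop> idn X) \<cdot> ((idn (P n) \<diamondop> mu p q) \<diamondop> idn X) \<cdot> (As (P n) (P p) (P q) \<diamondop> idn X)"
        by (simp add: interchange IH)
      also have "\<dots> = mu n (Suc (p + q)) \<cdot> As (P n) (P (p + q)) X \<cdot> ((idn (P n) \<diamondop> mu p q) \<diamondop> idn X) \<cdot> (As (P n) (P p) (P q) \<diamondop> idn X)"
        using q assms by (simp add: mu_Suc PS)
      also have "\<dots> = mu n (Suc (p + q)) \<cdot> (idn (P n) \<diamondop> (mu p q \<diamondop> idn X)) \<cdot> As (P n) (P p \<boxtimes> P q) X \<cdot> (As (P n) (P p) (P q) \<diamondop> idn X)"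
        by (simp add: As_natural_left)
      also have "\<dots> = mu n (Suc (p + q)) \<cdot> (idn (P n) \<diamondop> mu p (Suc q)) \<cdot> (idn (P n) \<diamondop> As (P p) (P q) X) \<cdot> As (P n) (P p \<boxtimes> P q) X \<cdot> (As (P n) (P p) (P q) \<diamondop> idn X)"
        using q assms by (simp add: mu_Suc interchange' PS)
      also have "\<dots> = mu n (Suc (p + q)) \<cdot> (idn (P n) \<diamondop> mu p (Suc q)) \<cdot> As (P n) (P p) (P q \<boxtimes> X) \<cdot> ?A"
        by (simp add: pentagon_arrow)
      also have "\<dots> = (mu n (p + Suc q) \<cdot> (idn (P n) \<diamondop> mu p (Suc q)) \<cdot> As (P n) (P p) (P (Suc q))) \<cdot> ?A"
        by (simp add: PS)
      finally show "(mu (n + p) (Suc q) \<cdot> (mu n p \<diamondop> idn (P (Suc q)))) \<cdot> ?A = \<dots>" .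
    qed (simp_all add: PS)
  qed
qed

lemma mu_0_right: "mu n 0 = Ru (P n)"
  by (cases n) (simp_all add: Lu_eq_Ru)

lemma nu_0_right: "nu n 0 = Ru' (P n)"
  using cancel_left[of "Ru (P n)" "nu n 0" "Ru' (P n)" "Ru' (P n)"] mu_nu(1)[of n 0]
  by (simp add: mu_0_right del: mu_nu)

text \<open>When an exponent vanishes, the claim is one of the unit laws: \<open>Lu_tns\<close>, the
  triangle or \<open>Ru_tns\<close>.\<close>

lemma mu_assoc:
  "mu (n + p) q \<cdot> (mu n p \<diamondop> idn (P q)) = mu n (p + q) \<cdot> (idn (P n) \<diamondop> mu p q) \<cdot> As (P n) (P p) (P q)"
proof -
  consider "n = 0" | "p = 0" | "q = 0" | "n > 0" "p > 0" "q > 0" by auto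
  then show ?thesis
  proof cases
    case 1
    have "mu p q \<cdot> (Lu (P p) \<diamondop> idn (P q)) = (mu p q \<cdot> Lu (P p \<boxtimes> P q)) \<cdot> As \<one> (P p) (P q)"
      by (simp flip: Lu_tns)
    also have "\<dots> = Lu (P (p + q)) \<cdot> (idn \<one> \<diamondop> mu p q) \<cdot> As \<one> (P p) (P q)"
      using Lu_natural[of "mu p q"] by (simp flip: cmp_assoc)
    finally show ?thesis using 1 by simp
  next
    case 2
    then show ?thesis by (simp add: mu_0_right triangle_arrow)
  next
    case 3
    have "Ru (P (n + p)) \<cdot> (mu n p \<diamondop> idn \<one>) = mu n p \<cdot> Ru (P n \<boxtimes> P p)"
      using Ru_natural[of "mu n p"] by simp
    also have "\<dots> = mu n p \<cdot> (idn (P n) \<diamondop> Ru (P p)) \<cdot> As (P n) (P p) \<one>"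
      by (simp add: Ru_tns)
    finally show ?thesis using 3 by (simp add: mu_0_right)
  qed (rule mu_assoc_pos)
qed

text \<open>Arrows between natural numbers stand for morphisms between tensor powers of \<open>X\<close>.  Conjugating
  with \<open>mu\<close> makes their tensor product strictly associative and unital.\<close>

definition emb :: "(nat, 'm) arrow \<Rightarrow> ('o, 'm) arrow" where
  "emb f = Arrow (P (src f)) (P (tgt f)) (val f)"

definition warr :: "(nat, 'm) arrow \<Rightarrow> bool" where
  "warr f \<longleftrightarrow> arr (emb f)"

definition ide :: "nat \<Rightarrow> (nat, 'm) arrow" where
  "ide n = Arrow n n (\<iota> (P n))"

definition pt :: "(nat, 'm) arrow \<Rightarrow> (nat, 'm) arrow \<Rightarrow> (nat, 'm) arrow"  (infixr \<open>\<bullet>\<close> 75) where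
  "f \<bullet> g = Arrow (src f + src g) (tgt f + tgt g)
     (val (mu (tgt f) (tgt g) \<cdot> (emb f \<diamondop> emb g) \<cdot> nu (src f) (src g)))"

lemma emb_simps [simp]: "src (emb f) = P (src f)" "tgt (emb f) = P (tgt f)" "val (emb f) = val f"
  by (simp_all add: emb_def)

lemma arr_emb [simp]: "arr (emb f) \<longleftrightarrow> warr f"
  by (simp add: warr_def)

text \<open>The objects \<open>P n\<close> need not be distinct for distinct \<open>n\<close>, so
  the numerical source and target are compared separately.\<close>

lemma emb_inject: "\<lbrakk>emb f = emb g; src f = src g; tgt f = tgt g\<rbrakk> \<Longrightarrow> f = g"
  by (cases f; cases g) (simp add: emb_def)

lemma ide_simps [simp]: "src (ide n) = n" "tgt (ide n) = n" "emb (ide n) = idn (P n)"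
  by (simp_all add: ide_def emb_def idn_def)

lemma warr_ide [simp]: "warr (ide n)"
  by (simp flip: arr_emb)

lemma emb_cmp [simp]: "emb (g \<cdot> f) = emb g \<cdot> emb f"
  by (simp add: emb_def cmp_def)

lemma warr_cmp [simp]: "\<lbrakk>warr g; warr f; src g = tgt f\<rbrakk> \<Longrightarrow> warr (g \<cdot> f)"
  by (simp flip: arr_emb)

lemma wcmp_assoc [simp]:
  "\<lbrakk>warr h; warr g; warr f; src h = tgt g; src g = tgt f\<rbrakk> \<Longrightarrow> (h \<cdot> g) \<cdot> f = h \<cdot> g \<cdot> f"
  by (rule emb_inject) simp_all

lemma ide_cmp [simp]: "\<lbrakk>warr f; n = tgt f\<rbrakk> \<Longrightarrow> ide n \<cdot> f = f" "\<lbrakk>warr f; n = src f\<rbrakk> \<Longrightarrow> f \<cdot> ide n = f"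
  by (rule emb_inject; simp)+

lemma pt_simps [simp]: "src (f \<bullet> g) = src f + src g" "tgt (f \<bullet> g) = tgt f + tgt g"
  "emb (f \<bullet> g) = mu (tgt f) (tgt g) \<cdot> (emb f \<diamondop> emb g) \<cdot> nu (src f) (src g)"
  by (simp_all add: pt_def emb_def cmp_def)

lemma warr_pt [simp]: "\<lbrakk>warr f; warr g\<rbrakk> \<Longrightarrow> warr (f \<bullet> g)"
  by (simp flip: arr_emb)

lemma pt_interchange:
  "\<lbrakk>warr g; warr f; warr g'; warr f'; src g = tgt f; src g' = tgt f'\<rbrakk>
    \<Longrightarrow> (g \<bullet> g') \<cdot> (f \<bullet> f') = (g \<cdot> f) \<bullet> (g' \<cdot> f')"
  by (rule emb_inject) (simp_all add: interchange')

lemma pt_ide [simp]: "ide n \<bullet> ide p = ide (n + p)"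
  by (rule emb_inject) simp_all

lemma pt_unit [simp]: "warr f \<Longrightarrow> ide 0 \<bullet> f = f" "warr f \<Longrightarrow> f \<bullet> ide 0 = f"
proof -
  assume f: "warr f"
  have "emb (ide 0 \<bullet> f) = (Lu (P (tgt f)) \<cdot> (idn \<one> \<diamondop> emb f)) \<cdot> Lu' (P (src f))"
    using f by simp
  also have "\<dots> = emb f"
    using f Lu_natural[of "emb f"] by simp
  finally show "ide 0 \<bullet> f = f"
    by (rule emb_inject) simp_all
next
  assume f: "warr f"
  have "emb (f \<bullet> ide 0) = (Ru (P (tgt f)) \<cdot> (emb f \<diamondop> idn \<one>)) \<cdot> Ru' (P (src f))"
    using f by (simp add: mu_0_right nu_0_right)
  also have "\<dots> = emb f"
    using f Ru_natural[of "emb f"] by simp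
  finally show "f \<bullet> ide 0 = f"
    by (rule emb_inject) simp_all
qed

text \<open>After precomposition with the invertible \<open>?w\<close>, this is
  \<open>mu_assoc\<close> at the targets, naturality of the associator, and \<open>mu_assoc\<close>
  at the sources.\<close>

lemma pt_assoc [simp]:
  assumes "warr f" "warr g" "warr h"
  shows "(f \<bullet> g) \<bullet> h = f \<bullet> g \<bullet> h"
proof (rule emb_inject)
  let ?w = "mu (src f + src g) (src h) \<cdot> (mu (src f) (src g) \<diamondop> idn (P (src h)))"
  let ?w' = "(nu (src f) (src g) \<diamondop> idn (P (src h))) \<cdot> nu (src f + src g) (src h)"
  show "emb ((f \<bullet> g) \<bullet> h) = emb (f \<bullet> g \<bullet> h)"
  proof (rule cancel_right[of _ ?w _ ?w'])
    have "emb ((f \<bullet> g) \<bullet> h) \<cdot> ?w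
      = mu (tgt f + tgt g) (tgt h) \<cdot> (mu (tgt f) (tgt g) \<diamondop> idn (P (tgt h))) \<cdot> ((emb f \<diamondop> emb g) \<diamondop> emb h)"
      using assms by (simp add: interchange interchange')
    also have "\<dots> = mu (tgt f) (tgt g + tgt h) \<cdot> (idn (P (tgt f)) \<diamondop> mu (tgt g) (tgt h)) \<cdot>
        As (P (tgt f)) (P (tgt g)) (P (tgt h)) \<cdot> ((emb f \<diamondop> emb g) \<diamondop> emb h)"
      using assms mu_assoc[of "tgt f" "tgt g" "tgt h"] cmp_assoc[of "mu (tgt f + tgt g) (tgt h)" "mu (tgt f) (tgt g) \<diamondop> idn (P (tgt h))" "(emb f \<diamondop> emb g) \<diamondop> emb h"]
      by (simp add: add.assoc)
    also have "\<dots> = mu (tgt f) (tgt g + tgt h) \<cdot> (idn (P (tgt f)) \<diamondop> mu (tgt g) (tgt h)) \<cdot>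
        (emb f \<diamondop> (emb g \<diamondop> emb h)) \<cdot> As (P (src f)) (P (src g)) (P (src h))"
      using assms As_natural[of "emb f" "emb g" "emb h"] by simp
    also have "\<dots> = emb (f \<bullet> g \<bullet> h) \<cdot> mu (src f) (src g + src h) \<cdot>
        (idn (P (src f)) \<diamondop> mu (src g) (src h)) \<cdot> As (P (src f)) (P (src g)) (P (src h))"
      using assms by (simp add: interchange')
    also have "\<dots> = emb (f \<bullet> g \<bullet> h) \<cdot> ?w"
      by (simp add: mu_assoc)
    finally show "emb ((f \<bullet> g) \<bullet> h) \<cdot> ?w = emb (f \<bullet> g \<bullet> h) \<cdot> ?w" .
  qed (use assms in \<open>simp_all add: interchange' interchange add.assoc\<close>)
qed (simp_all add: add.assoc)

lemma emb_scl [simp]: "emb (r \<star>\<star> f) = r \<star>\<star> emb f"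
  by (simp add: emb_def scl_def)

lemma emb_add [simp]: "emb (f \<oplus> g) = emb f \<oplus> emb g"
  by (simp add: emb_def add_def)

lemma warr_scl [simp]: "warr f \<Longrightarrow> warr (r \<star>\<star> f)"
  by (simp flip: arr_emb)

lemma warr_add [simp]: "\<lbrakk>warr f; warr g; src g = src f; tgt g = tgt f\<rbrakk> \<Longrightarrow> warr (f \<oplus> g)"
  by (simp flip: arr_emb)

text \<open>\<open>ap i g x\<close> glues \<open>g\<close> on top of \<open>x\<close>, to the right of the first \<open>i\<close> strands.\<close>

definition ap :: "nat \<Rightarrow> (nat, 'm) arrow \<Rightarrow> (nat, 'm) arrow \<Rightarrow> (nat, 'm) arrow" where
  "ap i g x = (ide i \<bullet> g \<bullet> ide (tgt x - i - src g)) \<cdot> x"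

lemma ap_simps [simp]: "src (ap i g x) = src x" "tgt (ap i g x) = i + tgt g + (tgt x - i - src g)"
  by (simp_all add: ap_def)

lemma warr_ap [simp]: "\<lbrakk>warr g; warr x; i + src g \<le> tgt x\<rbrakk> \<Longrightarrow> warr (ap i g x)"
  by (simp add: ap_def)

lemma ap_ide [simp]: "\<lbrakk>warr x; i + n \<le> tgt x\<rbrakk> \<Longrightarrow> ap i (ide n) x = x"
  by (simp add: ap_def)

lemma ap_to_ide [simp]: "\<lbrakk>warr g; n = src g\<rbrakk> \<Longrightarrow> ap 0 g (ide n) = g"
  by (simp add: ap_def)

lemma cmp_eq_ap: "\<lbrakk>warr g; src g = tgt f\<rbrakk> \<Longrightarrow> g \<cdot> f = ap 0 g f"
  by (simp add: ap_def)

text \<open>This rule transports an identity between small diagrams to any place in a larger one: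
  glue both sides onto \<open>x\<close> at offset \<open>i\<close> and flatten.\<close>

lemma ap_ap:
  assumes "warr g" "warr h" "warr x" "j + src g \<le> tgt h" "i + src h \<le> tgt x"
  shows "ap i (ap j g h) x = ap (i + j) g (ap i h x)"
proof -
  define l where "l = tgt h - j - src g"
  define r where "r = tgt x - i - src h"
  have th: "tgt h = j + src g + l" and tx: "tgt x = i + src h + r"
    using assms by (simp_all add: l_def r_def)
  have "ap i (ap j g h) x = (ide i \<bullet> ((ide j \<bullet> g \<bullet> ide l) \<cdot> h) \<bullet> ide r) \<cdot> x"
    by (simp add: ap_def th tx)
  also have "ide i \<bullet> ((ide j \<bullet> g \<bullet> ide l) \<cdot> h) \<bullet> ide r
      = (ide i \<bullet> ((ide j \<bullet> g \<bullet> ide l) \<bullet> ide r)) \<cdot> (ide i \<bullet> h \<bullet> ide r)"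
    using assms by (simp add: pt_interchange th add.assoc del: pt_assoc)
  also have "ide i \<bullet> ((ide j \<bullet> g \<bullet> ide l) \<bullet> ide r) = (ide i \<bullet> ide j) \<bullet> g \<bullet> (ide l \<bullet> ide r)"
    using assms by (simp del: pt_ide)
  also have "\<dots> = ide (i + j) \<bullet> g \<bullet> ide (l + r)"
    by simp
  finally show ?thesis
    using assms by (simp add: ap_def th tx)
qed

text \<open>Pieces on disjoint strands may exchange their heights, by the interchange law. As
  \<open>h\<close> lies to the right of \<open>g\<close>, its offset changes with the number of
  strands that \<open>g\<close> leaves.\<close>

lemma ap_far:
  assumes "warr g" "warr h" "warr x" "i + src g \<le> j" "j + src h \<le> tgt x"
  shows "ap i g (ap j h x) = ap (j - src g + tgt g) h (ap i g x)"
proof -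
  define l where "l = j - i - src g"
  define r where "r = tgt x - j - src h"
  have j: "j = i + src g + l" and tx: "tgt x = i + src g + l + src h + r"
    using assms by (simp_all add: l_def r_def)
  have "ap i g (ap j h x) = (ide i \<bullet> g \<bullet> (ide l \<bullet> ide (tgt h) \<bullet> ide r)) \<cdot> ((ide i \<bullet> ide (src g) \<bullet> ide l) \<bullet> h \<bullet> ide r) \<cdot> x"
    using assms by (simp add: ap_def j tx add.assoc)
  also have "\<dots> = ((ide i \<bullet> g \<bullet> (ide l \<bullet> ide (tgt h) \<bullet> ide r)) \<cdot> (ide i \<bullet> ide (src g) \<bullet> (ide l \<bullet> h \<bullet> ide r))) \<cdot> x"
    using assms by (simp add: j tx add.assoc del: pt_ide)
  also have "\<dots> = (ide i \<bullet> g \<bullet> (ide l \<bullet> h \<bullet> ide r)) \<cdot> x"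
    using assms by (simp add: pt_interchange del: pt_ide)
  also have "\<dots> = ((ide i \<bullet> ide (tgt g) \<bullet> (ide l \<bullet> h \<bullet> ide r)) \<cdot> (ide i \<bullet> g \<bullet> (ide l \<bullet> ide (src h) \<bullet> ide r))) \<cdot> x"
    using assms by (simp add: pt_interchange del: pt_ide)
  also have "\<dots> = ((ide i \<bullet> ide (tgt g) \<bullet> ide l) \<bullet> h \<bullet> ide r) \<cdot> (ide i \<bullet> g \<bullet> (ide l \<bullet> ide (src h) \<bullet> ide r)) \<cdot> x"
    using assms by (simp add: j tx add.assoc del: pt_ide)
  also have "\<dots> = ap (j - src g + tgt g) h (ap i g x)"
    using assms by (simp add: ap_def j tx add.assoc add.commute add.left_commute)
  finally show ?thesis .
qed

lemma pt_scl:
  assumes "warr f" "warr g"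
  shows "(r \<star>\<star> f) \<bullet> g = r \<star>\<star> (f \<bullet> g)" "f \<bullet> (r \<star>\<star> g) = r \<star>\<star> (f \<bullet> g)"
  using assms by (auto intro!: emb_inject simp: tns_scl cmp_scl)

lemma pt_add:
  assumes "warr f" "warr f'" "warr g" "src f' = src f" "tgt f' = tgt f"
  shows "(f \<oplus> f') \<bullet> g = f \<bullet> g \<oplus> f' \<bullet> g" "g \<bullet> (f \<oplus> f') = g \<bullet> f \<oplus> g \<bullet> f'"
  using assms by (auto intro!: emb_inject simp: tns_add cmp_add)

lemma wcmp_scl:
  assumes "warr g" "warr f" "src g = tgt f"
  shows "(r \<star>\<star> g) \<cdot> f = r \<star>\<star> (g \<cdot> f)" "g \<cdot> (r \<star>\<star> f) = r \<star>\<star> (g \<cdot> f)"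
  using assms by (auto intro!: emb_inject simp: cmp_scl)

lemma wcmp_add:
  assumes "warr g" "warr f" "warr h"
  shows "\<lbrakk>src g = tgt f; src h = tgt f; tgt h = tgt g\<rbrakk> \<Longrightarrow> (g \<oplus> h) \<cdot> f = g \<cdot> f \<oplus> h \<cdot> f"
    "\<lbrakk>src g = tgt f; tgt h = tgt f; src h = src f\<rbrakk> \<Longrightarrow> g \<cdot> (f \<oplus> h) = g \<cdot> f \<oplus> g \<cdot> h"
  using assms by (auto intro!: emb_inject simp: cmp_add)

lemma ap_scl [simp]:
  assumes "warr g" "warr x" "i + src g \<le> tgt x"
  shows "ap i (r \<star>\<star> g) x = r \<star>\<star> ap i g x" "ap i g (r \<star>\<star> x) = r \<star>\<star> ap i g x"
  using assms by (simp_all add: ap_def pt_scl wcmp_scl)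

lemma ap_add [simp]:
  assumes "warr g" "warr h" "warr x" "i + src g \<le> tgt x"
  shows "\<lbrakk>src h = src g; tgt h = tgt g\<rbrakk> \<Longrightarrow> ap i (g \<oplus> h) x = ap i g x \<oplus> ap i h x"
  using assms by (simp add: ap_def pt_add wcmp_add)

lemma ap_add_right [simp]:
  assumes "warr g" "warr x" "warr y" "i + src g \<le> tgt x" "tgt y = tgt x" "src y = src x"
  shows "ap i g (x \<oplus> y) = ap i g x \<oplus> ap i g y"
  using assms by (simp add: ap_def wcmp_add)

end

section \<open>Diagrams in a trivalent ribbon category\<close>

locale trivalent_diagrams = trivalent_ribbon_category C X ev coev \<tau>
  for C :: "('o, 'm::ab_group_add, complex, 'z) rib_cat_scheme" (structure)
    and X :: 'o and ev coev \<tau> :: 'm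
begin

sublocale monoidal_object C X ..

text \<open>Strand numbers are kept as numerals.\<close>

declare One_nat_def [simp del]
declare One_nat_def [symmetric, simp]

definition "cap = (Arrow 2 0 ev :: (nat, 'm) arrow)"
definition "cup = (Arrow 0 2 coev :: (nat, 'm) arrow)"
definition "tri = (Arrow 3 0 \<tau> :: (nat, 'm) arrow)"
definition "pos = (Arrow 2 2 (braid C X X) :: (nat, 'm) arrow)"
definition "neg = (Arrow 2 2 (neg_crossing C X) :: (nat, 'm) arrow)"
definition "mul = (Arrow 2 1 (vertex_m C X coev \<tau>) :: (nat, 'm) arrow)"
definition "spl = (Arrow 1 2 (vertex_delta C X coev \<tau>) :: (nat, 'm) arrow)"
definition "rung = (Arrow 2 2 (diagram_H C X coev \<tau>) :: (nat, 'm) arrow)"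

lemmas diagram_defs = cap_def cup_def tri_def pos_def neg_def mul_def spl_def rung_def

lemma diagram_simps [simp]:
  "src cap = 2" "tgt cap = 0" "src cup = 0" "tgt cup = 2" "src tri = 3" "tgt tri = 0"
  "src pos = 2" "tgt pos = 2" "src neg = 2" "tgt neg = 2"
  "src mul = 2" "tgt mul = 1" "src spl = 1" "tgt spl = 2" "src rung = 2" "tgt rung = 2"
  "val cap = ev" "val cup = coev" "val tri = \<tau>" "val pos = braid C X X" "val neg = neg_crossing C X"
  "val mul = vertex_m C X coev \<tau>" "val spl = vertex_delta C X coev \<tau>" "val rung = diagram_H C X coev \<tau>"
  by (simp_all add: diagram_defs)

lemma P_simps [simp]: "P 1 = X" "P 2 = X \<boxtimes> X" "P 3 = (X \<boxtimes> X) \<boxtimes> X" "P 4 = ((X \<boxtimes> X) \<boxtimes> X) \<boxtimes> X"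
  by (simp_all add: numeral_eq_Suc One_nat_def del: One_nat_def [symmetric])

lemma mu_numerals [simp]:
  "mu 1 1 = idn (X \<boxtimes> X)" "mu 2 1 = idn ((X \<boxtimes> X) \<boxtimes> X)" "mu 3 1 = idn (((X \<boxtimes> X) \<boxtimes> X) \<boxtimes> X)"
  "mu 1 2 = As' X X X" "mu 2 2 = As' (X \<boxtimes> X) X X"
  by (simp_all add: numeral_eq_Suc One_nat_def del: One_nat_def [symmetric])

lemma nu_numerals [simp]:
  "nu 1 1 = idn (X \<boxtimes> X)" "nu 2 1 = idn ((X \<boxtimes> X) \<boxtimes> X)" "nu 3 1 = idn (((X \<boxtimes> X) \<boxtimes> X) \<boxtimes> X)"
  "nu 1 2 = As X X X" "nu 2 2 = As (X \<boxtimes> X) X X"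
  by (simp_all add: numeral_eq_Suc One_nat_def del: One_nat_def [symmetric])

lemma warr_Arrow: "warr (Arrow n p f) \<longleftrightarrow> f \<in> hom C (P n) (P p)"
  by (simp add: arr_def flip: arr_emb)

lemma warr_generators [simp]: "warr cap" "warr cup" "warr tri" "warr pos" "warr neg"
proof -
  show "warr cap" "warr cup" using self_dual by (simp_all add: diagram_defs warr_Arrow duality_def)
  have "\<tau> \<in> box C X 3" using box_3 by (auto simp: box_basis_def hom_basis_def box_def)
  then show "warr tri" by (simp add: diagram_defs warr_Arrow box_def)
  show "warr pos" using Br_simps(3)[of X X] by (simp add: diagram_defs warr_Arrow arr_def)
  show "warr neg" using Br_simps(6)[of X X]
    by (simp add: diagram_defs warr_Arrow arr_def Br'_def neg_crossing_def)
qed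

lemma emb_pos: "emb pos = Br X X" and emb_neg: "emb neg = Br' X X"
  by (simp_all add: diagram_defs emb_def Br_def Br'_def neg_crossing_def)

text \<open>The associators and unitors in the definition are exactly the \<open>mu\<close> and
  \<open>nu\<close> hidden in the strict gluing, so the diagram can be handled without constraints
  from here on.\<close>

lemma mul_eq: "mul = ap 0 tri (ap 2 cup (ide 2))"
proof (rule emb_inject)
  have "emb mul = Lu X \<cdot> (emb tri \<diamondop> idn X) \<cdot> As' (X \<boxtimes> X) X X \<cdot> (idn (X \<boxtimes> X) \<diamondop> emb cup) \<cdot> Ru' (X \<boxtimes> X)"
    by (rule arrow.expand) (simp add: vertex_m_def tensor_ident)
  then show "emb mul = emb (ap 0 tri (ap 2 cup (ide 2)))"
    by (simp add: ap_def nu_0_right)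
qed simp_all

lemma warr_mul [simp]: "warr mul"
  by (simp add: mul_eq)

lemma spl_eq: "spl = ap 0 mul (ap 1 cup (ide 1))"
proof (rule emb_inject)
  have "emb spl = (emb mul \<diamondop> idn X) \<cdot> As' X X X \<cdot> (idn X \<diamondop> emb cup) \<cdot> Ru' X"
    by (rule arrow.expand) (simp add: vertex_delta_def)
  then show "emb spl = emb (ap 0 mul (ap 1 cup (ide 1)))"
    by (simp add: ap_def nu_0_right)
qed simp_all

lemma warr_spl [simp]: "warr spl"
  by (simp add: spl_eq)

lemma rung_eq: "rung = ap 1 mul (ap 0 spl (ide 2))"
proof (rule emb_inject)
  have "emb rung = (idn X \<diamondop> emb mul) \<cdot> As X X X \<cdot> (emb spl \<diamondop> idn X)"
    by (rule arrow.expand) (simp add: diagram_H_def)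
  then show "emb rung = emb (ap 1 mul (ap 0 spl (ide 2)))"
    by (simp add: ap_def nu_0_right)
qed simp_all

lemma warr_rung [simp]: "warr rung"
  by (simp add: rung_eq)

lemma zigzag_left: "ap 1 cap (ap 0 cup (ide 1)) = ide 1"
proof (rule emb_inject)
  have "Ru X \<cdot> (idn X \<diamondop> emb cap) \<cdot> As X X X \<cdot> (emb cup \<diamondop> idn X) \<cdot> Lu' X = idn X"
    by (rule arrow.expand) (use self_dual in \<open>simp add: duality_def\<close>)
  then show "emb (ap 1 cap (ap 0 cup (ide 1))) = emb (ide 1)"
    by (simp add: ap_def mu_0_right)
qed simp_all

lemma zigzag_right: "ap 0 cap (ap 1 cup (ide 1)) = ide 1"
proof (rule emb_inject)
  have "Lu X \<cdot> (emb cap \<diamondop> idn X) \<cdot> As' X X X \<cdot> (idn X \<diamondop> emb cup) \<cdot> Ru' X = idn X"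
    by (rule arrow.expand) (use self_dual in \<open>simp add: duality_def\<close>)
  then show "emb (ap 0 cap (ap 1 cup (ide 1))) = emb (ide 1)"
    by (simp add: ap_def nu_0_right)
qed simp_all

lemma pos_neg_inverse: "ap 0 pos neg = ide 2" "ap 0 neg pos = ide 2"
  by (rule emb_inject; simp add: ap_def emb_pos emb_neg)+

text \<open>By the second hexagon, two consecutive crossings are the braiding of a doubled strand
  with a single one. Naturality of \<open>Br\<close> then applies to whatever sits on the doubled
  strand.\<close>

lemma two_strands_over: "emb (ap 0 pos (ap 1 pos (ide 3))) = As' X X X \<cdot> Br (X \<boxtimes> X) X"
proof -
  have "(As' X X X \<cdot> Br (X \<boxtimes> X) X \<cdot> As' X X X) \<cdot> As X X X
      = ((Br X X \<diamondop> idn X) \<cdot> As' X X X \<cdot> (idn X \<diamondop> Br X X)) \<cdot> As X X X"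
    by (simp only: hexagon_inv_arrow)
  then show ?thesis by (simp add: ap_def emb_pos)
qed

lemma over_two_strands: "emb (ap 1 pos (ap 0 pos (ide 3))) = Br X (X \<boxtimes> X) \<cdot> As X X X"
proof -
  have "As' X X X \<cdot> (As X X X \<cdot> Br X (X \<boxtimes> X) \<cdot> As X X X)
      = As' X X X \<cdot> ((idn X \<diamondop> Br X X) \<cdot> As X X X \<cdot> (Br X X \<diamondop> idn X))"
    by (simp only: hexagon_arrow)
  then show ?thesis by (simp add: ap_def emb_pos)
qed

section \<open>One-dimensional spaces of diagrams and non-vanishing\<close>

sublocale vector_space "scal C"
  using module_axioms by (simp add: module_iff_vector_space)

lemma scl_cancel: "\<lbrakk>r \<star>\<star> f = q \<star>\<star> f; val f \<noteq> 0\<rbrakk> \<Longrightarrow> r = q"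
  by (auto simp: scl_def)

lemma zigzag:
  assumes "warr x" "i + 1 \<le> tgt x"
  shows "ap (i + 1) cap (ap i cup x) = x" "ap i cap (ap (i + 1) cup x) = x"
  using arg_cong[OF zigzag_left, of "\<lambda>f. ap i f x"] arg_cong[OF zigzag_right, of "\<lambda>f. ap i f x"] assms
  by (simp_all add: ap_ap)

lemma box_span: "box_basis C X n {f} \<Longrightarrow> hom C (P n) \<one> = range (\<lambda>r. r \<star> f)"
  by (simp add: box_basis_def hom_basis_def flip: span_singleton)

lemma scalar_box:
  assumes "box_basis C X n {val g}" "warr f" "warr g" "src f = n" "tgt f = 0" "src g = n" "tgt g = 0"
  shows "\<exists>r. f = r \<star>\<star> g"
proof -
  have "val f \<in> hom C (P n) \<one>" using assms by (simp add: arr_def flip: arr_emb)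
  then obtain r where "val f = r \<star> val g" using box_span[OF assms(1)] by auto
  then have "f = r \<star>\<star> g" using assms by (intro arrow.expand) simp
  then show ?thesis ..
qed

lemma scalar_cap: "\<lbrakk>warr f; src f = 2; tgt f = 0\<rbrakk> \<Longrightarrow> \<exists>r. f = r \<star>\<star> cap"
  using scalar_box[of 2 cap f] box_2 by simp

lemma scalar_tri: "\<lbrakk>warr f; src f = 3; tgt f = 0\<rbrakk> \<Longrightarrow> \<exists>r. f = r \<star>\<star> tri"
  using scalar_box[of 3 tri f] box_3 by simp

text \<open>Bending the outgoing strand down makes \<open>f\<close> a multiple of
  \<open>cap\<close>; bending it back recovers \<open>f\<close> by the zigzag identity. The next
  lemmas bend strands in the same way to reach a known box space.\<close>

lemma scalar_strand:
  assumes "warr f" "src f = 1" "tgt f = 1"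
  shows "\<exists>r. f = r \<star>\<star> ide 1"
proof -
  obtain r where r: "ap 0 cap (ap 0 f (ide 2)) = r \<star>\<star> cap"
    using scalar_cap[of "ap 0 cap (ap 0 f (ide 2))"] assms by auto
  have "f = ap 0 cap (ap 1 cup f)"
    using zigzag(2)[of f 0] assms by simp
  also have "\<dots> = ap 0 cap (ap 0 f (ap 1 cup (ide 1)))"
    using ap_far[of f cup "ide 1" 0 1] assms by simp
  also have "\<dots> = ap 0 (ap 0 cap (ap 0 f (ide 2))) (ap 1 cup (ide 1))"
    using assms by (simp add: ap_ap)
  also have "\<dots> = r \<star>\<star> ide 1"
    using zigzag(2)[of "ide 1" 0] by (simp add: r)
  finally show ?thesis by blast
qed

lemma scalar_mul:
  assumes "warr f" "src f = 2" "tgt f = 1"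
  shows "\<exists>r. f = r \<star>\<star> mul"
proof -
  obtain r where r: "ap 0 cap (ap 0 f (ide 3)) = r \<star>\<star> tri"
    using scalar_tri[of "ap 0 cap (ap 0 f (ide 3))"] assms by auto
  have "f = ap 0 cap (ap 1 cup f)"
    using zigzag(2)[of f 0] assms by simp
  also have "\<dots> = ap 0 cap (ap 0 f (ap 2 cup (ide 2)))"
    using ap_far[of f cup "ide 2" 0 2] assms by simp
  also have "\<dots> = ap 0 (ap 0 cap (ap 0 f (ide 3))) (ap 2 cup (ide 2))"
    using assms by (simp add: ap_ap)
  also have "\<dots> = r \<star>\<star> mul"
    by (simp add: r mul_eq)
  finally show ?thesis by blast
qed

lemma scalar_cup:
  assumes "warr f" "src f = 0" "tgt f = 2"
  shows "\<exists>r. f = r \<star>\<star> cup"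
proof -
  obtain r where r: "ap 1 cap (ap 0 f (ide 1)) = r \<star>\<star> ide 1"
    using scalar_strand[of "ap 1 cap (ap 0 f (ide 1))"] assms by auto
  have "f = ap 1 cap (ap 2 cup f)"
    using zigzag(2)[of f 1] assms by simp
  also have "\<dots> = ap 1 cap (ap 0 f cup)"
    using ap_far[of f cup "ide 0" 0 0] assms by simp
  also have "\<dots> = ap 0 (ap 1 cap (ap 0 f (ide 1))) cup"
    using assms by (simp add: ap_ap)
  also have "\<dots> = r \<star>\<star> cup"
    by (simp add: r)
  finally show ?thesis by blast
qed

lemma scalar_spl:
  assumes "warr f" "src f = 1" "tgt f = 2"
  shows "\<exists>r. f = r \<star>\<star> spl"
proof -
  obtain r where r: "ap 1 cap (ap 0 f (ide 2)) = r \<star>\<star> mul"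
    using scalar_mul[of "ap 1 cap (ap 0 f (ide 2))"] assms by auto
  have "f = ap 1 cap (ap 2 cup f)"
    using zigzag(2)[of f 1] assms by simp
  also have "\<dots> = ap 1 cap (ap 0 f (ap 1 cup (ide 1)))"
    using ap_far[of f cup "ide 1" 0 1] assms by simp
  also have "\<dots> = ap 0 (ap 1 cap (ap 0 f (ide 2))) (ap 1 cup (ide 1))"
    using assms by (simp add: ap_ap)
  also have "\<dots> = r \<star>\<star> spl"
    by (simp add: r spl_eq)
  finally show ?thesis by blast
qed

lemma no_one_point:
  assumes "warr f" "src f = 0" "tgt f = 1"
  shows "val f = 0"
proof -
  let ?g = "ap 0 cap (ap 0 f (ide 1))"
  have "val ?g \<in> box C X 1"
    using assms arr_emb[of ?g] by (simp add: box_def arr_def del: arr_emb)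
  \<comment> \<open>There is no single zero arrow, as arrows carry their types. A vanishing morphism
    is written as zero times itself, and linearity of \<open>ap\<close> carries the factor
    through.\<close>
  then have g: "?g = 0 \<star>\<star> ?g"
    using box_1 assms by (intro arrow.expand) auto
  have "f = ap 0 cap (ap 1 cup f)"
    using zigzag(2)[of f 0] assms by simp
  also have "\<dots> = ap 0 cap (ap 0 f cup)"
    using ap_far[of f cup "ide 0" 0 0] assms by simp
  also have "\<dots> = ap 0 ?g cup"
    using assms by (simp add: ap_ap)
  also have "\<dots> = ap 0 (0 \<star>\<star> ?g) cup"
    using g by simp
  also have "\<dots> = 0 \<star>\<star> ap 0 ?g cup"
    using assms by (intro ap_scl) simp_all
  finally have "val f = val (0 \<star>\<star> ap 0 ?g cup)" by simp
  then show ?thesis by simp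
qed

lemma mul_cup: "val (ap 0 mul cup) = 0"
  by (rule no_one_point) simp_all

lemma val_ide [simp]: "val (ide n) = \<iota> (P n)"
  by (simp add: ide_def)

lemma ide_0_nonzero: "val (ide 0) \<noteq> 0"
  using box_0 dependent_zero[of "{\<iota> \<one>}"] by (auto simp: box_basis_def hom_basis_def)

lemma cap_nonzero: "val cap \<noteq> 0"
  using box_2 dependent_zero[of "{ev}"] by (auto simp: box_basis_def hom_basis_def)

lemma tri_nonzero: "val tri \<noteq> 0"
  using box_3 dependent_zero[of "{\<tau>}"] by (auto simp: box_basis_def hom_basis_def)

lemma ap_zero:
  assumes "val g = 0 \<or> val x = 0" "warr g" "warr x" "i + src g \<le> tgt x"
  shows "val (ap i g x) = 0"
proof -
  have *: "f = 0 \<star>\<star> f" if "val f = 0" for f :: "(nat, 'm) arrow"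
    using that by (intro arrow.expand) auto
  have "ap i g x = 0 \<star>\<star> ap i g x"
    using assms * ap_scl[of g x i 0] by metis
  then show ?thesis by (metis scl_simps(3) scale_zero_left)
qed

text \<open>If one strand vanished, two strands would, and with them \<open>cap\<close>, which is a
  basis element.\<close>

lemma ide_1_nonzero: "val (ide 1) \<noteq> 0"
proof
  assume "val (ide 1) = 0"
  then have "val (ide 2) = 0" using ap_zero[of "ide 1" "ide 2" 0] by simp
  then have "val (ap 0 cap (ide 2)) = 0" by (intro ap_zero) simp_all
  moreover have "ap 0 cap (ide 2) = cap" by simp
  ultimately show False using cap_nonzero by metis
qed

lemma val_cmp: "\<lbrakk>warr g; src g = tgt f\<rbrakk> \<Longrightarrow> val g \<odot> val f = val (ap 0 g f)"
  using cmp_eq_ap[of g f] by (metis cmp_simps(3))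

lemma mul_spl_nonzero: "val (ap 0 mul spl) \<noteq> 0"
  using bigon_nonzero ide_1_nonzero val_cmp[of mul spl] by auto

lemma cap_cup_nonzero: "val (ap 0 cap cup) \<noteq> 0"
  using circle_nonzero ide_0_nonzero val_cmp[of cap cup] by auto

lemma mul_nonzero: "val mul \<noteq> 0"
  using mul_spl_nonzero ap_zero[of mul spl 0] by auto

lemma spl_nonzero: "val spl \<noteq> 0"
  using mul_spl_nonzero ap_zero[of mul spl 0] by auto

lemma cup_nonzero: "val cup \<noteq> 0"
  using cap_cup_nonzero ap_zero[of cap cup 0] by auto

section \<open>Crossings: cancellation and naturality\<close>

lemma pos_neg:
  assumes "warr x" "i + 2 \<le> tgt x"
  shows "ap i pos (ap i neg x) = x" "ap i neg (ap i pos x) = x"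
  using arg_cong[OF pos_neg_inverse(1), of "\<lambda>f. ap i f x"] arg_cong[OF pos_neg_inverse(2), of "\<lambda>f. ap i f x"] assms
    ap_ap[of pos neg x 0 i] ap_ap[of neg pos x 0 i]
  by simp_all

text \<open>Naturality of the braiding with the doubled strand in its first argument. For the cap,
  \<open>Ru_Br\<close> removes the remaining braiding with the unit; the case of \<open>neg\<close>
  is a mixed third Reidemeister move.\<close>

lemma slide_left:
  "ap 1 cap (ap 0 pos (ap 1 pos (ide 3))) = ap 0 cap (ide 3)"
  "ap 0 pos (ap 0 mul (ide 3)) = ap 1 mul (ap 0 pos (ap 1 pos (ide 3)))"
  "ap 1 neg (ap 0 pos (ap 1 pos (ide 3))) = ap 0 pos (ap 1 pos (ap 0 neg (ide 3)))"
  "ap 0 pos (ap 1 pos (ap 0 spl (ide 2))) = ap 1 spl pos"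
proof -
  have *: "emb (ap i f (ap 0 pos (ap 1 pos (ide 3)))) = emb (ap i f (ide 3)) \<cdot> As' X X X \<cdot> Br (X \<boxtimes> X) X"
    if "warr f" "i + src f \<le> 3" for i f
    using that by (simp add: ap_def flip: two_strands_over)
  show "ap 1 cap (ap 0 pos (ap 1 pos (ide 3))) = ap 0 cap (ide 3)"
  proof (rule emb_inject)
    have "emb (ap 1 cap (ap 0 pos (ap 1 pos (ide 3)))) = Ru X \<cdot> (idn X \<diamondop> emb cap) \<cdot> Br (X \<boxtimes> X) X"
      by (simp add: * mu_0_right) (simp add: ap_def mu_0_right)
    also have "\<dots> = (Ru X \<cdot> Br \<one> X) \<cdot> (emb cap \<diamondop> idn X)"
      using Br_natural[of "emb cap" "idn X"] by simp
    also have "\<dots> = emb (ap 0 cap (ide 3))"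
      by (simp add: Ru_Br ap_def)
    finally show "emb (ap 1 cap (ap 0 pos (ap 1 pos (ide 3)))) = emb (ap 0 cap (ide 3))" .
  qed simp_all
  show "ap 0 pos (ap 0 mul (ide 3)) = ap 1 mul (ap 0 pos (ap 1 pos (ide 3)))"
  proof (rule emb_inject)
    have "emb (ap 1 mul (ap 0 pos (ap 1 pos (ide 3)))) = (idn X \<diamondop> emb mul) \<cdot> Br (X \<boxtimes> X) X"
      by (simp add: *) (simp add: ap_def)
    also have "\<dots> = emb (ap 0 pos (ap 0 mul (ide 3)))"
      using Br_natural[of "emb mul" "idn X"] by (simp add: ap_def emb_pos)
    finally show "emb (ap 0 pos (ap 0 mul (ide 3))) = emb (ap 1 mul (ap 0 pos (ap 1 pos (ide 3))))" by simp
  qed simp_all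
  show "ap 1 neg (ap 0 pos (ap 1 pos (ide 3))) = ap 0 pos (ap 1 pos (ap 0 neg (ide 3)))"
  proof (rule emb_inject)
    have "emb (ap 1 neg (ap 0 pos (ap 1 pos (ide 3)))) = As' X X X \<cdot> (idn X \<diamondop> emb neg) \<cdot> Br (X \<boxtimes> X) X"
      by (simp add: *) (simp add: ap_def)
    also have "\<dots> = (As' X X X \<cdot> Br (X \<boxtimes> X) X) \<cdot> (emb neg \<diamondop> idn X)"
      using Br_natural[of "emb neg" "idn X"] by simp
    also have "\<dots> = emb (ap 0 pos (ap 1 pos (ap 0 neg (ide 3))))"
      by (simp add: ap_def flip: two_strands_over)
    finally show "emb (ap 1 neg (ap 0 pos (ap 1 pos (ide 3)))) = emb (ap 0 pos (ap 1 pos (ap 0 neg (ide 3))))" .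
  qed simp_all
  show "ap 0 pos (ap 1 pos (ap 0 spl (ide 2))) = ap 1 spl pos"
  proof (rule emb_inject)
    have "emb (ap 0 pos (ap 1 pos (ap 0 spl (ide 2)))) = (As' X X X \<cdot> Br (X \<boxtimes> X) X) \<cdot> (emb spl \<diamondop> idn X)"
      by (simp add: ap_def flip: two_strands_over)
    also have "\<dots> = emb (ap 1 spl pos)"
      using Br_natural[of "emb spl" "idn X"] by (simp add: ap_def emb_pos)
    finally show "emb (ap 0 pos (ap 1 pos (ap 0 spl (ide 2)))) = emb (ap 1 spl pos)" .
  qed simp_all
qed

text \<open>The same with the doubled strand in the second argument, now using the first hexagon and
  \<open>Lu_Br\<close>.\<close>

lemma slide_right:
  "ap 0 cap (ap 1 pos (ap 0 pos (ide 3))) = ap 1 cap (ide 3)"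
  "ap 1 pos (ap 0 pos (ap 1 spl (ide 2))) = ap 0 spl pos"
proof -
  show "ap 0 cap (ap 1 pos (ap 0 pos (ide 3))) = ap 1 cap (ide 3)"
  proof (rule emb_inject)
    have "emb (ap 0 cap (ap 1 pos (ap 0 pos (ide 3)))) = Lu X \<cdot> (emb cap \<diamondop> idn X) \<cdot> Br X (X \<boxtimes> X) \<cdot> As X X X"
      by (simp add: ap_def flip: over_two_strands)
    also have "\<dots> = (Lu X \<cdot> Br X \<one>) \<cdot> (idn X \<diamondop> emb cap) \<cdot> As X X X"
      using arg_cong[OF Br_natural[of "idn X" "emb cap"], of "\<lambda>f. f \<cdot> As X X X"] by simp
    also have "\<dots> = emb (ap 1 cap (ide 3))"
      by (simp add: Lu_Br ap_def mu_0_right)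
    finally show "emb (ap 0 cap (ap 1 pos (ap 0 pos (ide 3)))) = emb (ap 1 cap (ide 3))" .
  qed simp_all
  show "ap 1 pos (ap 0 pos (ap 1 spl (ide 2))) = ap 0 spl pos"
  proof (rule emb_inject)
    have "emb (ap 1 pos (ap 0 pos (ap 1 spl (ide 2)))) = (Br X (X \<boxtimes> X) \<cdot> As X X X) \<cdot> As' X X X \<cdot> (idn X \<diamondop> emb spl)"
      by (simp add: ap_def flip: over_two_strands)
    also have "\<dots> = emb (ap 0 spl pos)"
      using Br_natural[of "idn X" "emb spl"] by (simp add: ap_def emb_pos)
    finally show "emb (ap 1 pos (ap 0 pos (ap 1 spl (ide 2)))) = emb (ap 0 spl pos)" .
  qed simp_all
qed

end

section \<open>Eigenvalues of the crossing\<close>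

text \<open>The scalars exist because the spaces concerned are one-dimensional. \<open>l\<close>
  compares the two ways of bending a leg of \<open>tri\<close> upwards, on the left and, as in
  \<open>mul\<close>, on the right.\<close>

locale trivalent_scalars = trivalent_diagrams C X ev coev \<tau>
  for C :: "('o, 'm::ab_group_add, complex, 'z) rib_cat_scheme" (structure)
    and X :: 'o and ev coev \<tau> :: 'm +
  fixes d b w x l :: complex
  assumes circle: "ap 0 cap cup = d \<star>\<star> ide 0"
    and bigon: "ap 0 mul spl = b \<star>\<star> ide 1"
    and mul_neg: "ap 0 mul neg = w \<star>\<star> mul"
    and cap_neg: "ap 0 cap neg = x \<star>\<star> cap"
    and rotate: "ap 1 tri (ap 0 cup (ide 2)) = l \<star>\<star> mul"
begin

lemma d_nonzero: "d \<noteq> 0"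
  using cap_cup_nonzero circle by auto

lemma b_nonzero: "b \<noteq> 0"
  using mul_spl_nonzero bigon by auto

text \<open>Evaluating \<open>mul\<close> after \<open>neg\<close> after \<open>spl\<close> from
  either end gives the same multiple of the bigon, whose value \<open>b\<close> is not zero. So the
  eigenvalue agrees with that on \<open>mul\<close>.\<close>

lemma neg_spl: "ap 0 neg spl = w \<star>\<star> spl"
proof -
  obtain q where q: "ap 0 neg spl = q \<star>\<star> spl"
    using scalar_spl[of "ap 0 neg spl"] by auto
  have "ap 0 mul (ap 0 neg spl) = ap 0 (ap 0 mul neg) spl"
    by (simp add: ap_ap)
  then have "(q * b) \<star>\<star> ide 1 = (w * b) \<star>\<star> ide 1"
    by (simp add: q mul_neg bigon)
  then have "q * b = w * b"
    using ide_1_nonzero scl_cancel by metis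
  then show ?thesis using q b_nonzero by simp
qed

lemma neg_cup: "ap 0 neg cup = x \<star>\<star> cup"
proof -
  obtain q where q: "ap 0 neg cup = q \<star>\<star> cup"
    using scalar_cup[of "ap 0 neg cup"] by auto
  have "ap 0 cap (ap 0 neg cup) = ap 0 (ap 0 cap neg) cup"
    by (simp add: ap_ap)
  then have "(q * d) \<star>\<star> ide 0 = (x * d) \<star>\<star> ide 0"
    by (simp add: q cap_neg circle)
  then have "q * d = x * d"
    using ide_0_nonzero scl_cancel by metis
  then show ?thesis using q d_nonzero by simp
qed

lemma w_nonzero: "w \<noteq> 0"
proof
  assume "w = 0"
  have "mul = ap 0 mul (ap 0 neg pos)"
    by (simp add: pos_neg_inverse)
  also have "\<dots> = ap 0 (ap 0 mul neg) pos"
    by (simp add: ap_ap)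
  also have "\<dots> = w \<star>\<star> ap 0 mul pos"
    by (simp add: mul_neg)
  finally have "val mul = val (w \<star>\<star> ap 0 mul pos)" by metis
  then show False using \<open>w = 0\<close> mul_nonzero by (simp del: diagram_simps)
qed

lemma x_nonzero: "x \<noteq> 0"
proof
  assume "x = 0"
  have "cap = ap 0 cap (ap 0 neg pos)"
    by (simp add: pos_neg_inverse)
  also have "\<dots> = ap 0 (ap 0 cap neg) pos"
    by (simp add: ap_ap)
  also have "\<dots> = x \<star>\<star> ap 0 cap pos"
    by (simp add: cap_neg)
  finally have "val cap = val (x \<star>\<star> ap 0 cap pos)" by metis
  then show False using \<open>x = 0\<close> cap_nonzero by (simp del: diagram_simps)
qed

text \<open>Straightening the bent leg writes the nonzero \<open>tri\<close> as \<open>l\<close>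
  times a diagram.\<close>

lemma l_nonzero: "l \<noteq> 0"
proof
  assume "l = 0"
  have "tri = ap 0 tri (ap 0 cap (ap 1 cup (ide 3)))"
    using zigzag(2)[of "ide 3" 0] by simp
  also have "\<dots> = ap 0 cap (ap 2 tri (ap 1 cup (ide 3)))"
    using ap_far[of cap tri "ap 1 cup (ide 3)" 0 2] by simp
  also have "\<dots> = ap 0 cap (ap 1 (ap 1 tri (ap 0 cup (ide 2))) (ide 3))"
    by (simp add: ap_ap)
  also have "\<dots> = l \<star>\<star> ap 0 cap (ap 1 mul (ide 3))"
    by (simp add: rotate)
  finally have "val tri = val (l \<star>\<star> ap 0 cap (ap 1 mul (ide 3)))" by metis
  then show False using \<open>l = 0\<close> tri_nonzero by (simp del: diagram_simps)
qed

section \<open>Local moves at an arbitrary position\<close>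

lemma loops:
  assumes "warr y"
  shows "i \<le> tgt y \<Longrightarrow> ap i cap (ap i cup y) = d \<star>\<star> y"
    and "i + 1 \<le> tgt y \<Longrightarrow> ap i mul (ap i spl y) = b \<star>\<star> y"
  using arg_cong[OF circle, of "\<lambda>f. ap i f y"] arg_cong[OF bigon, of "\<lambda>f. ap i f y"] assms
  by (simp_all add: ap_ap)

lemma twist_neg:
  assumes "warr y"
  shows "i + 2 \<le> tgt y \<Longrightarrow> ap i mul (ap i neg y) = w \<star>\<star> ap i mul y"
    and "i + 2 \<le> tgt y \<Longrightarrow> ap i cap (ap i neg y) = x \<star>\<star> ap i cap y"
    and "i + 1 \<le> tgt y \<Longrightarrow> ap i neg (ap i spl y) = w \<star>\<star> ap i spl y"
    and "i \<le> tgt y \<Longrightarrow> ap i neg (ap i cup y) = x \<star>\<star> ap i cup y"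
  using arg_cong[OF mul_neg, of "\<lambda>f. ap i f y"] arg_cong[OF cap_neg, of "\<lambda>f. ap i f y"]
    arg_cong[OF neg_spl, of "\<lambda>f. ap i f y"] arg_cong[OF neg_cup, of "\<lambda>f. ap i f y"] assms
  by (simp_all add: ap_ap)

lemma twist_pos:
  assumes "warr y"
  shows "i + 2 \<le> tgt y \<Longrightarrow> ap i cap (ap i pos y) = (1 / x) \<star>\<star> ap i cap y"
    and "i + 1 \<le> tgt y \<Longrightarrow> ap i pos (ap i spl y) = (1 / w) \<star>\<star> ap i spl y"
    and "i \<le> tgt y \<Longrightarrow> ap i pos (ap i cup y) = (1 / x) \<star>\<star> ap i cup y"
proof -
  show "ap i cap (ap i pos y) = (1 / x) \<star>\<star> ap i cap y" if "i + 2 \<le> tgt y"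
    using twist_neg(2)[of "ap i pos y" i] that assms x_nonzero pos_neg[of y i] by simp
  show "ap i pos (ap i spl y) = (1 / w) \<star>\<star> ap i spl y" if "i + 1 \<le> tgt y"
    using arg_cong[OF twist_neg(3)[of y i], of "\<lambda>f. (1 / w) \<star>\<star> ap i pos f"] that assms w_nonzero
      pos_neg[of "ap i spl y" i] by simp
  show "ap i pos (ap i cup y) = (1 / x) \<star>\<star> ap i cup y" if "i \<le> tgt y"
    using arg_cong[OF twist_neg(4)[of y i], of "\<lambda>f. (1 / x) \<star>\<star> ap i pos f"] that assms x_nonzero
      pos_neg[of "ap i cup y" i] by simp
qed

lemma cap_mul:
  assumes "warr y" "i + 3 \<le> tgt y"
  shows "ap i cap (ap i mul y) = ap i tri y"
proof -
  have "ap 0 cap (ap 0 mul (ide 3)) = ap 0 cap (ap 0 tri (ap 2 cup (ide 3)))"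
    by (simp add: mul_eq ap_ap)
  also have "\<dots> = ap 0 tri (ap 3 cap (ap 2 cup (ide 3)))"
    using ap_far[of tri cap "ap 2 cup (ide 3)" 0 3] by simp
  also have "\<dots> = tri"
    using zigzag(1)[of "ide 3" 2] by simp
  finally have "ap 0 cap (ap 0 mul (ide 3)) = tri" .
  from arg_cong[OF this, of "\<lambda>f. ap i f y"] show ?thesis
    using assms by (simp add: ap_ap)
qed

lemma cap_spl:
  assumes "warr y" "i + 2 \<le> tgt y"
  shows "ap (i + 1) cap (ap i spl y) = ap i mul y"
proof -
  have "ap 1 cap (ap 0 spl (ide 2)) = ap 1 cap (ap 0 mul (ap 1 cup (ide 2)))"
    by (simp add: spl_eq ap_ap)
  also have "\<dots> = ap 0 mul (ap 2 cap (ap 1 cup (ide 2)))"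
    using ap_far[of mul cap "ap 1 cup (ide 2)" 0 2] by simp
  also have "\<dots> = mul"
    using zigzag(1)[of "ide 2" 1] by simp
  finally have "ap 1 cap (ap 0 spl (ide 2)) = mul" .
  from arg_cong[OF this, of "\<lambda>f. ap i f y"] show ?thesis
    using assms by (simp add: ap_ap)
qed

lemma tri_cup:
  assumes "warr y" "i + 2 \<le> tgt y"
  shows "ap (i + 1) tri (ap i cup y) = l \<star>\<star> ap i mul y"
  using arg_cong[OF rotate, of "\<lambda>f. ap i f y"] assms by (simp add: ap_ap)

lemma mul_cup_left:
  assumes "warr y" "i + 1 \<le> tgt y"
  shows "ap (i + 1) mul (ap i cup y) = l \<star>\<star> ap i spl y"
proof -
  have "ap 1 mul (ap 0 cup (ide 1)) = ap 1 tri (ap 3 cup (ap 0 cup (ide 1)))"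
    by (simp add: mul_eq ap_ap)
  also have "\<dots> = ap 1 tri (ap 0 cup (ap 1 cup (ide 1)))"
    using ap_far[of cup cup "ide 1" 0 1] by simp
  also have "\<dots> = l \<star>\<star> spl"
    using tri_cup[of "ap 1 cup (ide 1)" 0] by (simp add: spl_eq)
  finally have "ap 1 mul (ap 0 cup (ide 1)) = l \<star>\<star> spl" .
  from arg_cong[OF this, of "\<lambda>f. ap i f y"] show ?thesis
    using assms by (simp add: ap_ap)
qed

lemma cap_mul_right:
  assumes "warr y" "i + 3 \<le> tgt y"
  shows "l \<star>\<star> ap i cap (ap (i + 1) mul y) = ap i tri y"
proof -
  have "l \<star>\<star> ap 0 cap (ap 1 mul (ide 3)) = ap 0 cap (ap 2 tri (ap 1 cup (ide 3)))"
    using tri_cup[of "ide 3" 1] by simp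
  also have "\<dots> = ap 0 tri (ap 0 cap (ap 1 cup (ide 3)))"
    using ap_far[of cap tri "ap 1 cup (ide 3)" 0 2] by simp
  also have "\<dots> = tri"
    using zigzag(2)[of "ide 3" 0] by simp
  finally have "l \<star>\<star> ap 0 cap (ap 1 mul (ide 3)) = tri" .
  from arg_cong[OF this, of "\<lambda>f. ap i f y"] show ?thesis
    using assms by (simp add: ap_ap)
qed

lemma cap_spl_right:
  assumes "warr y" "i + 2 \<le> tgt y"
  shows "l \<star>\<star> ap i cap (ap (i + 1) spl y) = ap i mul y"
proof -
  have "l \<star>\<star> ap 0 cap (ap 1 spl (ide 2)) = l \<star>\<star> ap 0 cap (ap 1 mul (ap 2 cup (ide 2)))"
    by (simp add: spl_eq ap_ap)
  also have "\<dots> = ap 0 tri (ap 2 cup (ide 2))"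
    using cap_mul_right[of "ap 2 cup (ide 2)" 0] by simp
  finally have "l \<star>\<star> ap 0 cap (ap 1 spl (ide 2)) = mul"
    by (simp add: mul_eq)
  from arg_cong[OF this, of "\<lambda>f. ap i f y"] show ?thesis
    using assms by (simp add: ap_ap)
qed

text \<open>Splitting either end of a cup gives a vertex with three legs up; passing from one to the
  other rotates the vertex, which costs \<open>l\<close>.\<close>

lemma spl_cup:
  assumes "warr y" "i \<le> tgt y"
  shows "ap (i + 1) spl (ap i cup y) = l \<star>\<star> ap i spl (ap i cup y)"
proof -
  have "ap 1 spl (ap 0 cup (ide 0)) = ap 1 mul (ap 2 cup (ap 0 cup (ide 0)))"
    by (simp add: spl_eq ap_ap)
  also have "\<dots> = ap 1 mul (ap 0 cup (ap 0 cup (ide 0)))"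
    using ap_far[of cup cup "ide 0" 0 0] by simp
  also have "\<dots> = l \<star>\<star> ap 0 spl (ap 0 cup (ide 0))"
    using mul_cup_left[of "ap 0 cup (ide 0)" 0] by simp
  finally have "ap 1 spl (ap 0 cup (ide 0)) = l \<star>\<star> ap 0 spl (ap 0 cup (ide 0))" .
  from arg_cong[OF this, of "\<lambda>f. ap i f y"] show ?thesis
    using assms
    by (simp add: ap_ap)
qed

lemma slides:
  assumes "warr y"
  shows "i + 3 \<le> tgt y \<Longrightarrow> ap (i + 1) cap (ap i pos (ap (i + 1) pos y)) = ap i cap y"
    and "i + 3 \<le> tgt y \<Longrightarrow> ap i pos (ap i mul y) = ap (i + 1) mul (ap i pos (ap (i + 1) pos y))"
    and "i + 3 \<le> tgt y \<Longrightarrow> ap (i + 1) neg (ap i pos (ap (i + 1) pos y)) = ap i pos (ap (i + 1) pos (ap i neg y))"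
    and "i + 2 \<le> tgt y \<Longrightarrow> ap i pos (ap (i + 1) pos (ap i spl y)) = ap (i + 1) spl (ap i pos y)"
    and "i + 3 \<le> tgt y \<Longrightarrow> ap i cap (ap (i + 1) pos (ap i pos y)) = ap (i + 1) cap y"
    and "i + 2 \<le> tgt y \<Longrightarrow> ap (i + 1) pos (ap i pos (ap (i + 1) spl y)) = ap i spl (ap i pos y)"
  using arg_cong[OF slide_left(1), of "\<lambda>f. ap i f y"] arg_cong[OF slide_left(2), of "\<lambda>f. ap i f y"]
    arg_cong[OF slide_left(3), of "\<lambda>f. ap i f y"] arg_cong[OF slide_left(4), of "\<lambda>f. ap i f y"]
    arg_cong[OF slide_right(1), of "\<lambda>f. ap i f y"] arg_cong[OF slide_right(2), of "\<lambda>f. ap i f y"] assms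
  by (simp_all add: ap_ap)

text \<open>A strand that crosses one leg of a cap can be moved to the other leg. These are the
  first and the fifth slide, applied to a diagram that begins with a negative crossing so that one
  crossing cancels.\<close>

lemma cap_slides:
  assumes "warr y" "i + 3 \<le> tgt y"
  shows "ap (i + 1) cap (ap i pos y) = ap i cap (ap (i + 1) neg y)"
    and "ap (i + 1) cap (ap i neg y) = ap i cap (ap (i + 1) pos y)"
proof -
  show "ap (i + 1) cap (ap i pos y) = ap i cap (ap (i + 1) neg y)"
    using slides(1)[of "ap (i + 1) neg y" i] assms pos_neg[of y "i + 1"] by simp
  show "ap (i + 1) cap (ap i neg y) = ap i cap (ap (i + 1) pos y)"
    using slides(5)[of "ap i neg y" i] assms pos_neg[of y i] by simp
qed

lemma spl_slides:
  assumes "warr y" "i + 2 \<le> tgt y"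
  shows "ap i spl (ap i neg y) = ap (i + 1) neg (ap i neg (ap (i + 1) spl y))"
    and "ap (i + 1) spl (ap i neg y) = ap i neg (ap (i + 1) neg (ap i spl y))"
proof -
  have "ap i pos (ap (i + 1) pos (ap i spl (ap i neg y))) = ap (i + 1) spl y"
    using slides(4)[of "ap i neg y" i] assms pos_neg[of y i] by simp
  then show "ap i spl (ap i neg y) = ap (i + 1) neg (ap i neg (ap (i + 1) spl y))"
    using assms pos_neg[of "ap (i + 1) pos (ap i spl (ap i neg y))" i] pos_neg[of "ap i spl (ap i neg y)" "i + 1"]
    by simp
  have "ap (i + 1) pos (ap i pos (ap (i + 1) spl (ap i neg y))) = ap i spl y"
    using slides(6)[of "ap i neg y" i] assms pos_neg[of y i] by simp
  then show "ap (i + 1) spl (ap i neg y) = ap i neg (ap (i + 1) neg (ap i spl y))"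
    using assms pos_neg[of "ap i pos (ap (i + 1) spl (ap i neg y))" "i + 1"] pos_neg[of "ap (i + 1) spl (ap i neg y)" i]
    by simp
qed

lemma mul_slide:
  assumes "warr y" "i + 3 \<le> tgt y"
  shows "ap i neg (ap (i + 1) mul y) = ap i mul (ap (i + 1) neg (ap i neg y))"
proof -
  have "ap i pos (ap i mul (ap (i + 1) neg (ap i neg y))) = ap (i + 1) mul y"
    using slides(2)[of "ap (i + 1) neg (ap i neg y)" i] assms pos_neg[of y i] pos_neg[of "ap i neg y" "i + 1"]
    by simp
  then show ?thesis
    using assms pos_neg[of "ap i mul (ap (i + 1) neg (ap i neg y))" i] by simp
qed

text \<open>By \<open>spl_cup\<close> the vertex with three legs up is also, up to \<open>l\<close>,
  a split of its last two legs, so a crossing of those has the usual eigenvalue.\<close>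

lemma pos_tripod:
  assumes "warr y" "i \<le> tgt y"
  shows "ap (i + 1) pos (ap i spl (ap i cup y)) = (1 / w) \<star>\<star> ap i spl (ap i cup y)"
proof -
  let ?z = "ap i spl (ap i cup y)"
  have z: "?z = (1 / l) \<star>\<star> ap (i + 1) spl (ap i cup y)"
    using spl_cup[of y i] assms l_nonzero by simp
  have "ap (i + 1) pos ?z = (1 / l) \<star>\<star> ap (i + 1) pos (ap (i + 1) spl (ap i cup y))"
    using assms by (subst z) simp
  also have "\<dots> = (1 / w) \<star>\<star> ?z"
    using assms twist_pos(2)[of "ap i cup y" "i + 1"] by (subst z) (simp add: mult.commute)
  finally show ?thesis .
qed

text \<open>Compute a curl followed by a vertex in two ways: remove the curl first, or pull the vertex
  through it.\<close>

lemma curl: "x = l * w\<^sup>2"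
proof -
  define z where "z = ap 1 cup (ide 1)"
  have z [simp]: "warr z" "src z = 1" "tgt z = 3" by (simp_all add: z_def)
  have "ap 1 cap (ap 0 neg z) = ap 0 cap (ap 1 pos z)"
    using cap_slides(2)[of z 0] by simp
  also have "\<dots> = (1 / x) \<star>\<star> ide 1"
    using zigzag(2)[of "ide 1" 0] twist_pos(3)[of "ide 1" 1] by (simp add: z_def)
  finally have "ap 0 spl (ap 1 cap (ap 0 neg z)) = (1 / x) \<star>\<star> spl"
    by simp
  moreover have "ap 0 spl (ap 1 cap (ap 0 neg z)) = (1 / (l * w\<^sup>2)) \<star>\<star> spl"
  proof -
    have *: "ap 2 pos (ap 1 spl z) = (1 / w) \<star>\<star> ap 1 spl z"
      using pos_tripod[of "ide 1" 1] by (simp add: z_def)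
    \<comment> \<open>Once the vertex has passed the crossing, the two crossings left become
      positive at the caps and are absorbed by the vertex for \<open>1 / w\<close> each; the last
      bend costs \<open>1 / l\<close>.\<close>
    have "ap 0 spl (ap 1 cap (ap 0 neg z)) = ap 2 cap (ap 0 spl (ap 0 neg z))"
      using ap_far[of spl cap "ap 0 neg z" 0 1] by simp
    also have "\<dots> = ap 2 cap (ap 1 neg (ap 0 neg (ap 1 spl z)))"
      using spl_slides(1)[of z 0] by simp
    also have "\<dots> = ap 1 cap (ap 2 pos (ap 0 neg (ap 1 spl z)))"
      using cap_slides(2)[of "ap 0 neg (ap 1 spl z)" 1] by simp
    also have "\<dots> = ap 1 cap (ap 0 neg (ap 2 pos (ap 1 spl z)))"
      using ap_far[of neg pos "ap 1 spl z" 0 2] by simp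
    also have "\<dots> = (1 / w) \<star>\<star> ap 0 cap (ap 1 pos (ap 1 spl z))"
      using cap_slides(2)[of "ap 1 spl z" 0] by (simp add: *)
    also have "\<dots> = (1 / w\<^sup>2) \<star>\<star> ap 0 cap (ap 1 spl z)"
      using twist_pos(2)[of z 1] by (simp add: power2_eq_square)
    also have "\<dots> = (1 / (l * w\<^sup>2)) \<star>\<star> ap 0 mul z"
      using cap_spl_right[of z 0, symmetric] l_nonzero by simp
    also have "ap 0 mul z = spl"
      by (simp add: z_def spl_eq)
    finally show ?thesis .
  qed
  ultimately have "1 / x = 1 / (l * w\<^sup>2)"
    using scl_cancel spl_nonzero by metis
  then show ?thesis
    using x_nonzero w_nonzero l_nonzero by (simp add: field_simps)
qed

text \<open>Swapping the two vertices of the theta graph multiplies its value by \<open>w\<^sup>2 / x\<close>.\<close>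

lemma theta: "x = w\<^sup>2"
proof -
  \<comment> \<open>A cup with both ends split: two vertices with four legs up. Two nested caps
    close it to the theta graph.\<close>
  define y where "y = ap 2 spl (ap 0 spl cup)"
  have y [simp]: "warr y" "src y = 0" "tgt y = 4" by (simp_all add: y_def)
  have y': "y = ap 0 spl (ap 1 spl cup)"
    using ap_far[of spl spl cup 0 1] by (simp add: y_def)
  have theta_value: "ap 0 cap (ap 1 cap y) = (l * b * d) \<star>\<star> ide 0"
    using cap_spl[of "ap 1 spl cup" 0] spl_cup[of "ide 0" 0] loops(2)[of cup 0] by (simp add: y' circle)
  \<comment> \<open>A crossing inserted in the edge between the vertices is pulled up through both
    of them. This exchanges the vertices and leaves four crossings above.\<close>
  have cup: "cup = x \<star>\<star> ap 0 pos cup"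
    using twist_pos(3)[of "ide 0" 0] x_nonzero by simp
  have "y = ap 2 spl (ap 0 spl (x \<star>\<star> ap 0 pos cup))"
    unfolding y_def by (subst cup) simp
  also have "\<dots> = x \<star>\<star> ap 2 spl (ap 0 spl (ap 0 pos cup))"
    by simp
  also have "ap 2 spl (ap 0 spl (ap 0 pos cup)) = ap 2 spl (ap 1 pos (ap 0 pos (ap 1 spl cup)))"
    using slides(6)[of cup 0] by simp
  also have "\<dots> = ap 1 pos (ap 2 pos (ap 1 spl (ap 0 pos (ap 1 spl cup))))"
    using slides(4)[of "ap 0 pos (ap 1 spl cup)" 1] by simp
  also have "\<dots> = ap 1 pos (ap 2 pos (ap 0 pos (ap 1 pos y)))"
    using slides(4)[of "ap 1 spl cup" 0] by (simp add: y')
  finally have swap: "y = x \<star>\<star> ap 1 pos (ap 2 pos (ap 0 pos (ap 1 pos y)))" .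
  \<comment> \<open>Two of the four crossings are absorbed by caps, for \<open>1 / x\<close> each;
    the other two end up as negative crossings on a vertex, for \<open>w\<close> each.\<close>
  have "ap 0 cap (ap 1 cap y) = ap 0 cap (ap 1 cap (x \<star>\<star> ap 1 pos (ap 2 pos (ap 0 pos (ap 1 pos y)))))"
    by (rule arg_cong[OF swap])
  also have "\<dots> = x \<star>\<star> ap 0 cap (ap 1 cap (ap 1 pos (ap 2 pos (ap 0 pos (ap 1 pos y)))))"
    by simp
  also have "\<dots> = ap 0 cap (ap 1 cap (ap 2 pos (ap 0 pos (ap 1 pos y))))"
    using twist_pos(1)[of "ap 2 pos (ap 0 pos (ap 1 pos y))" 1] x_nonzero by simp
  also have "\<dots> = ap 0 cap (ap 2 cap (ap 1 neg (ap 0 pos (ap 1 pos y))))"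
    using cap_slides(2)[of "ap 0 pos (ap 1 pos y)" 1] by simp
  also have "\<dots> = ap 0 cap (ap 0 cap (ap 1 neg (ap 0 pos (ap 1 pos y))))"
    using ap_far[of cap cap "ap 1 neg (ap 0 pos (ap 1 pos y))" 0 2] by simp
  also have "\<dots> = ap 0 cap (ap 0 cap (ap 0 pos (ap 1 pos (ap 0 neg y))))"
    using slides(3)[of y 0] by simp
  also have "\<dots> = (1 / x) \<star>\<star> ap 0 cap (ap 0 cap (ap 1 pos (ap 0 neg y)))"
    using twist_pos(1)[of "ap 1 pos (ap 0 neg y)" 0] by simp
  also have "\<dots> = (w / x) \<star>\<star> ap 0 cap (ap 0 cap (ap 1 pos y))"
    using twist_neg(3)[of "ap 1 spl cup" 0] by (simp add: y')
  also have "\<dots> = (w / x) \<star>\<star> ap 0 cap (ap 1 cap (ap 0 neg y))"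
    using cap_slides(2)[of y 0] by simp
  also have "\<dots> = (w\<^sup>2 / x) \<star>\<star> ap 0 cap (ap 1 cap y)"
    using twist_neg(3)[of "ap 1 spl cup" 0] by (simp add: y' power2_eq_square)
  finally have "(l * b * d) = (w\<^sup>2 / x) * (l * b * d)"
    using theta_value ide_0_nonzero scl_cancel by (metis scl_scl)
  then show ?thesis
    using l_nonzero b_nonzero d_nonzero x_nonzero by (simp add: field_simps)
qed

text \<open>Compare \<open>curl\<close> with \<open>theta\<close>. This is the rotational invariance
  of the vertex; as a simplification rule it removes \<open>l\<close> from all the local
  moves.\<close>

lemma l_eq_1 [simp]: "l = 1"
  using curl theta w_nonzero by simp

section \<open>Rotation\<close>

text \<open>The cup bends the left input of \<open>f\<close> up and the cap bends its right output
  down: a quarter turn. The crossing glued on top makes the cube of \<open>rot\<close> act on the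
  six diagrams as the scalar \<open>x\<close>.\<close>

definition rot :: "(nat, 'm) arrow \<Rightarrow> (nat, 'm) arrow" where
  "rot f = ap 0 neg (ap 2 cap (ap 1 f (ap 0 cup (ide 2))))"

lemma rot_identity: "rot (ide 2) = x \<star>\<star> ap 0 cup cap"
  using ap_far[of cup cap "ide 2" 0 0] twist_neg(4)[of cap 0] by (simp add: rot_def)

lemma rot_cup_cap: "rot (ap 0 cup cap) = neg"
  using zigzag(1)[of "ide 2" 0] zigzag(1)[of "ap 1 cap (ap 0 cup (ide 2))" 1]
  by (simp add: rot_def ap_ap)

text \<open>A quarter turn makes the negative crossing positive, and the crossing in
  \<open>rot\<close> cancels it.\<close>

lemma rot_neg: "rot neg = ide 2"
  using cap_slides(2)[of "ap 0 cup (ide 2)" 1] ap_far[of cup pos "ide 2" 0 0] zigzag(1)[of pos 0]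
  by (simp add: rot_def pos_neg_inverse)

text \<open>The crossing slides up through the splitting vertex of the rung and doubles; the merging
  vertex absorbs one of the two crossings.\<close>

lemma rung_neg: "ap 0 rung neg = w \<star>\<star> ap 1 mul (ap 0 neg (ap 1 spl (ide 2)))"
  using spl_slides(1)[of "ide 2" 0] twist_neg(1)[of "ap 0 neg (ap 1 spl (ide 2))" 1]
  by (simp add: rung_eq ap_ap)

text \<open>The rung can be tilted either way: both forms equal two splitting vertices joined by a
  cap, by rotational invariance.\<close>

lemma rung_eq': "rung = ap 0 mul (ap 1 spl (ide 2))"
proof -
  have "rung = ap 1 cap (ap 2 spl (ap 0 spl (ide 2)))"
    using cap_spl_right[of "ap 0 spl (ide 2)" 1] by (simp add: rung_eq)
  also have "\<dots> = ap 1 cap (ap 0 spl (ap 1 spl (ide 2)))"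
    using ap_far[of spl spl "ide 2" 0 1] by simp
  also have "\<dots> = ap 0 mul (ap 1 spl (ide 2))"
    using cap_spl[of "ap 1 spl (ide 2)" 0] by simp
  finally show ?thesis .
qed

text \<open>Both composites are \<open>w\<close> times the same diagram with one crossing: the
  crossing slides through \<open>rung_eq\<close> from above and through \<open>rung_eq'\<close> from
  below.\<close>

lemma neg_rung: "ap 0 neg rung = ap 0 rung neg"
proof -
  have "ap 0 neg rung = w \<star>\<star> ap 0 mul (ap 1 neg (ap 0 spl (ide 2)))"
    using mul_slide[of "ap 0 spl (ide 2)" 0] twist_neg(3)[of "ide 2" 0] by (simp add: rung_eq)
  also have "\<dots> = ap 0 rung neg"
    using spl_slides(2)[of "ide 2" 0] twist_neg(1)[of "ap 1 neg (ap 0 spl (ide 2))" 0]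
    by (simp add: rung_eq' ap_ap)
  finally show ?thesis .
qed

text \<open>A quarter turn takes the tree \<open>I\<close> to the rung, and \<open>neg_rung\<close>
  moves the crossing below it.\<close>

lemma rot_spl_mul: "rot (ap 0 spl mul) = ap 0 rung neg"
proof -
  have "rot (ap 0 spl mul) = ap 0 neg rung"
    using cap_spl[of "ap 1 mul (ap 0 cup (ide 2))" 1] mul_cup_left[of "ide 2" 0]
    by (simp add: rot_def rung_eq ap_ap)
  then show ?thesis by (simp add: neg_rung)
qed

lemma rot_rung: "rot rung = w \<star>\<star> ap 0 spl mul"
proof -
  let ?y = "ap 0 cup (ide 2)"
  have "ap 2 cap (ap 1 rung ?y) = ap 2 tri (ap 1 spl ?y)"
    using cap_mul[of "ap 1 spl ?y" 2] by (simp add: rung_eq ap_ap)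
  also have "\<dots> = ap 2 tri (ap 0 spl ?y)"
    using spl_cup[of "ide 2" 0] by simp
  also have "\<dots> = ap 0 spl (ap 1 tri ?y)"
    using ap_far[of spl tri ?y 0 1] by simp
  also have "\<dots> = ap 0 spl mul"
    using tri_cup[of "ide 2" 0] by simp
  finally show ?thesis
    using twist_neg(3)[of mul 0] by (simp add: rot_def)
qed

text \<open>The crossing becomes positive when it passes the cap and cancels against the one in
  \<open>rot\<close>; what remains is the rung with the factor of \<open>rung_neg\<close>.\<close>

lemma rot_rung_neg: "rot (ap 0 rung neg) = w \<star>\<star> rung"
proof -
  let ?y = "ap 2 spl (ap 0 cup (ide 2))"
  have "ap 2 cap (ap 1 (ap 0 rung neg) (ap 0 cup (ide 2))) = w \<star>\<star> ap 2 tri (ap 1 neg ?y)"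
    using cap_mul[of "ap 1 neg ?y" 2] by (simp add: rung_neg ap_ap)
  also have "\<dots> = w \<star>\<star> ap 2 cap (ap 3 mul (ap 1 neg ?y))"
    using cap_mul_right[of "ap 1 neg ?y" 2] by simp
  also have "\<dots> = w \<star>\<star> ap 2 cap (ap 1 neg (ap 3 mul ?y))"
    using ap_far[of neg mul ?y 1 3] by simp
  also have "\<dots> = w \<star>\<star> ap 1 cap (ap 2 pos (ap 3 mul ?y))"
    using cap_slides(2)[of "ap 3 mul ?y" 1] by simp
  also have "ap 3 mul ?y = ap 0 cup rung"
    using ap_far[of cup spl "ide 2" 0 0] ap_far[of cup mul "ap 0 spl (ide 2)" 0 1] by (simp add: rung_eq)
  also have "ap 1 cap (ap 2 pos (ap 0 cup rung)) = ap 0 pos rung"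
    using ap_far[of cup pos rung 0 0] zigzag(1)[of "ap 0 pos rung" 0] by simp
  finally show ?thesis
    using pos_neg[of rung 0] by (simp add: rot_def)
qed

end

section \<open>The relation\<close>

text \<open>Stated for families, since some of the six diagrams might coincide and a set would lose
  the repetition. Two equal members give a relation with coefficients 1 and -1.\<close>

lemma (in vector_space) family_dependent:
  assumes "finite B" "f ` {..<n} \<subseteq> span B" "card B < n"
  obtains u where "\<exists>j<n. u j \<noteq> 0" "(\<Sum>j<n. scale (u j) (f j)) = 0"
proof (cases "inj_on f {..<n}")
  case True
  have "dependent (f ` {..<n})"
  proof (rule ccontr)
    assume "\<not> dependent (f ` {..<n})"
    then have "card (f ` {..<n}) \<le> card B"
      using independent_span_bound assms by blast
    then show False using assms True by (simp add: card_image)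
  qed
  then obtain u where u: "\<exists>v\<in>f ` {..<n}. u v \<noteq> 0" "(\<Sum>v\<in>f ` {..<n}. scale (u v) v) = 0"
    using dependent_finite[of "f ` {..<n}"] by auto
  show ?thesis
    by (rule that[of "u \<circ> f"]) (use u True in \<open>auto simp: sum.reindex\<close>)
next
  case False
  then obtain i j where ij: "i < n" "j < n" "i \<noteq> j" "f i = f j"
    by (auto simp: inj_on_def)
  let ?u = "\<lambda>k. if k = i then 1 else if k = j then - 1 else 0 :: 'a"
  have "(\<Sum>k<n. scale (?u k) (f k)) = (\<Sum>k\<in>{i, j}. scale (?u k) (f k))"
    using ij by (intro sum.mono_neutral_right) auto
  also have "\<dots> = 0"
    using ij by simp
  finally show ?thesis
    using ij by (intro that[of ?u]) auto
qed

text \<open>Rescaling of the six coefficients in \<open>eigen_rel\<close>, with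
  \<open>g / (v ^ 3 * f)\<close> in the role of \<alpha>.\<close>

lemma normalize_coefficients:
  fixes v f g :: complex
  assumes "v \<noteq> 0" "f \<noteq> 0"
  shows "1 / (v ^ 7 * f) * (v ^ 8 * f) = v" "1 / (v ^ 7 * f) * - (v ^ 6 * f) = - (1 / v)"
    "1 / (v ^ 7 * f) * (v ^ 4 * f) = 1 / v ^ 3" "1 / (v ^ 7 * f) * (v ^ 8 * g) = g / (v ^ 3 * f) * v ^ 4"
    "1 / (v ^ 7 * f) * g = g / (v ^ 3 * f) / v ^ 4" "1 / (v ^ 7 * f) * (v ^ 4 * g) = g / (v ^ 3 * f)"
  using assms by (simp_all add: divide_simps eval_nat_numeral)

text \<open>The premises are what \<open>rel_cup\<close> and \<open>rel_spl\<close> give for the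
  final relation, with \<open>x = v ^ 12\<close> and \<open>w = - (v ^ 6)\<close>. Division by
  \<open>v ^ 4\<close> and by \<open>v\<close> yields the claims.\<close>

lemma scalar_identities:
  fixes v b d t \<alpha> :: complex
  assumes v: "v \<noteq> 0"
  shows "- (1 / v) * b + 1 / v ^ 3 * v ^ 12 * b + \<alpha> * v ^ 4 * d + \<alpha> / v ^ 4 + \<alpha> * v ^ 12 = 0 \<Longrightarrow>
      vdiff v 5 * b = - \<alpha> * (d + vsum v 8)"
    and "v * b + - (1 / v) * t + 1 / v ^ 3 * - (v ^ 6) * t + \<alpha> / v ^ 4 + \<alpha> * - (v ^ 6) = 0 \<Longrightarrow>
      vsum v 2 * t = b - vdiff v 5 * \<alpha>"
proof -
  have powi: "v powi 5 = v ^ 5" "v powi (- 5) = 1 / v ^ 5" "v powi 8 = v ^ 8" "v powi (- 8) = 1 / v ^ 8"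
    "v powi 2 = v ^ 2" "v powi (- 2) = 1 / v ^ 2"
    by (simp_all add: power_int_def divide_inverse power_inverse)
  have "vdiff v 5 * b + \<alpha> * (d + vsum v 8)
      = (- (1 / v) * b + 1 / v ^ 3 * v ^ 12 * b + \<alpha> * v ^ 4 * d + \<alpha> / v ^ 4 + \<alpha> * v ^ 12) / v ^ 4"
    unfolding vdiff_def vsum_def powi using v by (simp add: divide_simps) (simp add: eval_nat_numeral algebra_simps)
  then show "- (1 / v) * b + 1 / v ^ 3 * v ^ 12 * b + \<alpha> * v ^ 4 * d + \<alpha> / v ^ 4 + \<alpha> * v ^ 12 = 0 \<Longrightarrow>
      vdiff v 5 * b = - \<alpha> * (d + vsum v 8)"
    by (simp add: eq_neg_iff_add_eq_0)
  have "b - vdiff v 5 * \<alpha> - vsum v 2 * t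
      = (v * b + - (1 / v) * t + 1 / v ^ 3 * - (v ^ 6) * t + \<alpha> / v ^ 4 + \<alpha> * - (v ^ 6)) / v"
    unfolding vdiff_def vsum_def powi using v by (simp add: divide_simps) (simp add: eval_nat_numeral algebra_simps)
  then show "v * b + - (1 / v) * t + 1 / v ^ 3 * - (v ^ 6) * t + \<alpha> / v ^ 4 + \<alpha> * - (v ^ 6) = 0 \<Longrightarrow>
      vsum v 2 * t = b - vdiff v 5 * \<alpha>"
    by simp
qed

lemma sum_lessThan_6: "(\<Sum>j<(6::nat). f j) = f 0 + f 1 + f 2 + f 3 + f 4 + f 5"
  by (simp add: eval_nat_numeral)

lemma ex_less_6: "(\<exists>j<(6::nat). Q j) \<longleftrightarrow> Q 0 \<or> Q 1 \<or> Q 2 \<or> Q 3 \<or> Q 4 \<or> Q 5"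
  by (auto simp: eval_nat_numeral less_Suc_eq)

section \<open>Linear relations between the six diagrams\<close>

context trivalent_scalars
begin

text \<open>Trees first, pairings second, each triple in an order which \<open>rot\<close> permutes
  cyclically up to scalars.\<close>

definition comb :: "complex \<Rightarrow> complex \<Rightarrow> complex \<Rightarrow> complex \<Rightarrow> complex \<Rightarrow> complex \<Rightarrow> (nat, 'm) arrow" where
  "comb p q r p' q' r' = p \<star>\<star> ap 0 spl mul \<oplus> q \<star>\<star> rung \<oplus> r \<star>\<star> ap 0 rung neg
     \<oplus> p' \<star>\<star> ap 0 cup cap \<oplus> q' \<star>\<star> ide 2 \<oplus> r' \<star>\<star> neg"

definition rel :: "complex \<Rightarrow> complex \<Rightarrow> complex \<Rightarrow> complex \<Rightarrow> complex \<Rightarrow> complex \<Rightarrow> bool" where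
  "rel p q r p' q' r' \<longleftrightarrow> val (comb p q r p' q' r') = 0"

lemma comb_simps [simp]: "warr (comb p q r p' q' r')" "src (comb p q r p' q' r') = 2" "tgt (comb p q r p' q' r') = 2"
  by (simp_all add: comb_def)

lemma rot_add: "\<lbrakk>warr f; warr g; src f = 2; tgt f = 2; src g = 2; tgt g = 2\<rbrakk> \<Longrightarrow> rot (f \<oplus> g) = rot f \<oplus> rot g"
  by (simp add: rot_def)

lemma rot_scl: "\<lbrakk>warr f; src f = 2; tgt f = 2\<rbrakk> \<Longrightarrow> rot (r \<star>\<star> f) = r \<star>\<star> rot f"
  by (simp add: rot_def)

lemma rel_rot:
  assumes "rel p q r p' q' r'"
  shows "rel (w * q) (w * r) p (x * q') r' p'"
proof -
  have "val (rot (comb p q r p' q' r')) = 0"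
    using assms by (simp add: rot_def rel_def ap_zero)
  also have "rot (comb p q r p' q' r') = comb (w * q) (w * r) p (x * q') r' p'"
    by (rule arrow.expand)
      (simp add: comb_def rot_add rot_scl rot_identity rot_cup_cap rot_neg rot_spl_mul rot_rung rot_rung_neg,
       simp add: rot_def algebra_simps)
  finally show ?thesis by (simp add: rel_def)
qed

lemma rel_scale:
  assumes "rel p q r p' q' r'"
  shows "rel (a * p) (a * q) (a * r) (a * p') (a * q') (a * r')"
proof -
  have "val (comb (a * p) (a * q) (a * r) (a * p') (a * q') (a * r')) = a \<star> val (comb p q r p' q' r')"
    by (simp add: comb_def scale_right_distrib)
  then show ?thesis using assms by (simp add: rel_def)
qed

lemma rel_add:
  assumes "rel p q r p' q' r'" "rel s\<^sub>1 s\<^sub>2 s\<^sub>3 s\<^sub>4 s\<^sub>5 s\<^sub>6"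
  shows "rel (p + s\<^sub>1) (q + s\<^sub>2) (r + s\<^sub>3) (p' + s\<^sub>4) (q' + s\<^sub>5) (r' + s\<^sub>6)"
proof -
  have "val (comb (p + s\<^sub>1) (q + s\<^sub>2) (r + s\<^sub>3) (p' + s\<^sub>4) (q' + s\<^sub>5) (r' + s\<^sub>6))
      = val (comb p q r p' q' r') + val (comb s\<^sub>1 s\<^sub>2 s\<^sub>3 s\<^sub>4 s\<^sub>5 s\<^sub>6)"
    by (simp add: comb_def scale_left_distrib algebra_simps)
  then show ?thesis using assms by (simp add: rel_def)
qed

lemma scale_zero_iff: "val f \<noteq> 0 \<Longrightarrow> r \<star> val f = 0 \<longleftrightarrow> r = 0"
  by simp

lemma cap_spl_zero: "val (ap 0 cap spl) = 0"
proof -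
  have "val (ap 0 cap spl) \<in> box C X 1"
    using arr_emb[of "ap 0 cap spl"] by (simp add: box_def arr_def del: arr_emb)
  then show ?thesis using box_1 by auto
qed

text \<open>On the nonzero \<open>spl\<close> each diagram acts by a scalar. \<open>U\<close>
  contributes nothing, because a cap on a vertex lies in the one-point space, which is zero.\<close>

lemma rel_spl:
  assumes "rel p q r p' q' r'" and t: "ap 0 rung spl = t \<star>\<star> spl"
  shows "p * b + q * t + r * w * t + q' + r' * w = 0"
proof -
  have z: "val (ap 0 (ap 0 cup cap) spl) = 0"
    using cap_spl_zero by (simp add: ap_ap ap_zero)
  have "val (ap 0 (comb p q r p' q' r') spl) = (p * b + q * t + r * w * t + q' + r' * w) \<star> val spl"
    using z by (simp add: comb_def) (simp add: ap_ap bigon neg_spl t scale_left_distrib)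
  moreover have "val (ap 0 (comb p q r p' q' r') spl) = 0"
    using assms by (simp add: rel_def ap_zero)
  ultimately show ?thesis using scale_zero_iff[OF spl_nonzero] by metis
qed

text \<open>The split at the left end of the cup can be moved to the right end, where it forms a
  bigon with the merging vertex.\<close>

lemma rung_cup: "ap 0 rung cup = b \<star>\<star> cup"
  using spl_cup[of "ide 0" 0] loops(2)[of cup 1] by (simp add: rung_eq ap_ap)

lemma rel_cup:
  assumes "rel p q r p' q' r'"
  shows "q * b + r * x * b + p' * d + q' + r' * x = 0"
proof -
  have z: "val (ap 0 (ap 0 spl mul) cup) = 0"
    using mul_cup by (simp add: ap_ap ap_zero)
  have "val (ap 0 (comb p q r p' q' r') cup) = (q * b + r * x * b + p' * d + q' + r' * x) \<star> val cup"
    using z by (simp add: comb_def) (simp add: ap_ap circle neg_cup rung_cup scale_left_distrib)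
  moreover have "val (ap 0 (comb p q r p' q' r') cup) = 0"
    using assms by (simp add: rel_def ap_zero)
  ultimately show ?thesis using scale_zero_iff[OF cup_nonzero] by metis
qed

text \<open>Bending both outputs down embeds the endomorphisms of two strands in the four-point
  space; the two cups undo it. So relations found there can be pulled back.\<close>

lemma close_open:
  assumes "warr f" "src f = 2" "tgt f = 2"
  shows "ap 0 (ap 0 cap (ap 1 cap (ap 0 f (ide 4)))) (ap 3 cup (ap 2 cup (ide 2))) = f"
proof -
  have "ap 0 (ap 0 cap (ap 1 cap (ap 0 f (ide 4)))) (ap 3 cup (ap 2 cup (ide 2)))
      = ap 0 cap (ap 1 cap (ap 0 f (ap 3 cup (ap 2 cup (ide 2)))))"
    using assms by (simp add: ap_ap)
  also have "\<dots> = ap 0 cap (ap 1 cap (ap 3 cup (ap 2 cup f)))"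
    using assms ap_far[of f cup "ap 2 cup (ide 2)" 0 3] ap_far[of f cup "ide 2" 0 2] by simp
  also have "\<dots> = ap 0 cap (ap 1 cup (ap 1 cap (ap 2 cup f)))"
    using assms ap_far[of cap cup "ap 2 cup f" 1 3] by simp
  also have "\<dots> = f"
    using assms zigzag(2)[of f 1] zigzag(2)[of f 0] by simp
  finally show ?thesis .
qed

lemma exists_rel:
  assumes "box_basis C X 4 B" "finite B" "card B \<le> 5"
  shows "\<exists>p q r p' q' r'. rel p q r p' q' r' \<and> \<not> (p = 0 \<and> q = 0 \<and> r = 0 \<and> p' = 0 \<and> q' = 0 \<and> r' = 0)"
proof -
  define close where "close f = ap 0 cap (ap 1 cap (ap 0 f (ide 4)))" for f :: "(nat, 'm) arrow"
  define fs where "fs j = (if j = 0 then ap 0 spl mul else if j = 1 then rung else if j = 2 then ap 0 rung neg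
    else if j = 3 then ap 0 cup cap else if j = 4 then ide 2 else neg)" for j :: nat
  have fs: "warr (fs j) \<and> src (fs j) = 2 \<and> tgt (fs j) = 2" for j
    by (simp add: fs_def)
  have "val (close (fs j)) \<in> span B" for j
  proof -
    have "val (close (fs j)) \<in> box C X 4"
      using fs[of j] arr_emb[of "close (fs j)"] by (simp add: close_def box_def arr_def del: arr_emb)
    then show ?thesis using assms(1) by (simp add: box_basis_def hom_basis_def box_def)
  qed
  then have "(\<lambda>j. val (close (fs j))) ` {..<6} \<subseteq> span B" by auto
  moreover have "card B < 6" using assms(3) by simp
  ultimately obtain u where u: "\<exists>j<6. u j \<noteq> 0" "(\<Sum>j<6. u j \<star> val (close (fs j))) = 0"
    by (rule family_dependent[OF assms(2)])
  let ?g = "comb (u 0) (u 1) (u 2) (u 3) (u 4) (u 5)"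
  have "val (close ?g) = (\<Sum>j<6. u j \<star> val (close (fs j)))"
    by (simp add: comb_def close_def fs_def sum_lessThan_6)
  then have "val (close ?g) = 0" using u by simp
  then have "val (ap 0 (close ?g) (ap 3 cup (ap 2 cup (ide 2)))) = 0"
    by (intro ap_zero) (simp_all add: close_def)
  then have "rel (u 0) (u 1) (u 2) (u 3) (u 4) (u 5)"
    using close_open[of ?g] by (simp add: rel_def close_def)
  moreover have "\<not> (u 0 = 0 \<and> u 1 = 0 \<and> u 2 = 0 \<and> u 3 = 0 \<and> u 4 = 0 \<and> u 5 = 0)"
    using u(1) by (simp add: ex_less_6)
  ultimately show ?thesis by blast
qed

text \<open>If the crossing is a combination of the two planar pairings, then expanding it on both sides
  of \<open>rung_neg\<close> gives a relation between the trees.\<close>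

lemma exists_tree_rel:
  assumes "rel p q r p' q' r'" "\<not> (p = 0 \<and> q = 0 \<and> r = 0 \<and> p' = 0 \<and> q' = 0 \<and> r' = 0)"
  shows "\<exists>p q r p' q' r'. rel p q r p' q' r' \<and> \<not> (p = 0 \<and> q = 0 \<and> r = 0)"
proof (cases "p = 0 \<and> q = 0 \<and> r = 0")
  case False
  then show ?thesis using assms by blast
next
  case True
  \<comment> \<open>Otherwise closing off with \<open>spl\<close> would kill \<open>q'\<close>, and
    then closing off with \<open>cup\<close> would kill \<open>p'\<close>.\<close>
  have "r' \<noteq> 0"
  proof
    assume "r' = 0"
    obtain t where "ap 0 rung spl = t \<star>\<star> spl"
      using scalar_spl[of "ap 0 rung spl"] by auto
    then have "q' = 0" using rel_spl assms(1) True \<open>r' = 0\<close> by fastforce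
    then have "p' * d = 0" using rel_cup[OF assms(1)] True \<open>r' = 0\<close> by simp
    then show False using d_nonzero assms(2) True \<open>r' = 0\<close> \<open>q' = 0\<close> by simp
  qed
  define g where "g = - p' / r'"
  define h where "h = - q' / r'"
  have "rel 0 0 0 (- g) (- h) 1"
    using rel_scale[OF assms(1), of "1 / r'"] True \<open>r' \<noteq> 0\<close> by (simp add: g_def h_def)
  then have "- (g \<star> val (ap 0 cup cap)) - h \<star> val (ide 2) + val neg = 0"
    by (simp add: rel_def comb_def)
  moreover have "val neg = (- (g \<star> val (ap 0 cup cap)) - h \<star> val (ide 2) + val neg)
      + (g \<star> val (ap 0 cup cap) + h \<star> val (ide 2))"
    by simp
  ultimately have "val neg = g \<star> val (ap 0 cup cap) + h \<star> val (ide 2)"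
    by (metis add_0)
  then have neg: "neg = g \<star>\<star> ap 0 cup cap \<oplus> h \<star>\<star> ide 2"
    by (intro arrow.expand) simp
  have "ap 0 rung neg = g \<star>\<star> ap 0 rung (ap 0 cup cap) \<oplus> h \<star>\<star> rung"
    by (subst neg) simp
  also have "ap 0 rung (ap 0 cup cap) = ap 0 (ap 0 rung cup) cap"
    by (simp add: ap_ap)
  also have "\<dots> = b \<star>\<star> ap 0 cup cap"
    by (simp add: rung_cup)
  finally have left: "ap 0 rung neg = (g * b) \<star>\<star> ap 0 cup cap \<oplus> h \<star>\<star> rung"
    by simp
  \<comment> \<open>The second expansion, in the form where the crossing sits inside the rung: the
    cup-cap term turns into the tree \<open>I\<close>, the identity term into a bigon.\<close>
  have "ap 0 rung neg = w \<star>\<star> ap 1 mul (ap 0 (g \<star>\<star> ap 0 cup cap \<oplus> h \<star>\<star> ide 2) (ap 1 spl (ide 2)))"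
    by (subst neg[symmetric]) (rule rung_neg)
  also have "\<dots> = (w * g) \<star>\<star> ap 1 mul (ap 0 cup (ap 0 cap (ap 1 spl (ide 2)))) \<oplus> (w * h * b) \<star>\<star> ide 2"
    using loops(2)[of "ide 2" 1]
    by (intro arrow.expand) (simp_all add: ap_ap scale_right_distrib mult.assoc)
  also have "\<dots> = (w * g) \<star>\<star> ap 0 spl mul \<oplus> (w * h * b) \<star>\<star> ide 2"
    using cap_spl_right[of "ide 2" 0] mul_cup_left[of mul 0] by simp
  finally have "val (ap 0 rung neg) = val ((w * g) \<star>\<star> ap 0 spl mul \<oplus> (w * h * b) \<star>\<star> ide 2)"
    by (rule arg_cong)
  moreover have "val (ap 0 rung neg) = val ((g * b) \<star>\<star> ap 0 cup cap \<oplus> h \<star>\<star> rung)"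
    by (rule arg_cong[OF left])
  ultimately have "rel (- (w * g)) h 0 (g * b) (- (w * h * b)) 0"
    by (simp add: rel_def comb_def algebra_simps)
  \<comment> \<open>If both tree coefficients vanished, so would the crossing, which acts on
    \<open>spl\<close> by the nonzero \<open>w\<close>.\<close>
  moreover have "\<not> (- (w * g) = 0 \<and> h = 0 \<and> (0::complex) = 0)"
  proof
    assume "- (w * g) = 0 \<and> h = 0 \<and> (0::complex) = 0"
    then have "g = 0" "h = 0" using w_nonzero by auto
    then have "val neg = 0" by (subst neg) simp
    then have "val (ap 0 neg spl) = 0" by (intro ap_zero) (simp_all del: diagram_simps(24))
    then show False using w_nonzero spl_nonzero by (simp add: neg_spl del: diagram_simps)
  qed
  ultimately show ?thesis by blast
qed

text \<open>The witness is the relation projected to the eigenvalue \<open>v ^ 4\<close> of \<open>rot\<close>.\<close>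

lemma eigen_rel:
  assumes "rel p q r p' q' r'" and v: "v \<noteq> 0" "w = - (v ^ 6)" and nz: "p - v\<^sup>2 * q + v ^ 4 * r \<noteq> 0"
  obtains \<alpha> where "rel v (- (1 / v)) (1 / v ^ 3) (\<alpha> * v ^ 4) (\<alpha> / v ^ 4) \<alpha>"
proof -
  define f where "f = p - v\<^sup>2 * q + v ^ 4 * r"
  have f: "f \<noteq> 0" using nz by (simp add: f_def)
  define g where "g = p' + v ^ 8 * q' + v ^ 4 * r'"
  have x: "x = v ^ 12" using theta v by simp
  note R1 = rel_rot[OF assms(1)]
  note R2 = rel_rot[OF R1]
  \<comment> \<open>As the cube of \<open>rot\<close> is \<open>v ^ 12\<close> on coefficients,
    weighting the relation and its two rotations by \<open>v ^ 8\<close>, \<open>v ^ 4\<close> and 1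
    projects to the eigenvalue \<open>v ^ 4\<close>. The trees keep the factor \<open>f\<close>, the
    pairings \<open>g\<close>.\<close>
  have "rel (v ^ 8 * f) (- (v ^ 6 * f)) (v ^ 4 * f) (v ^ 8 * g) g (v ^ 4 * g)"
    using rel_add[OF rel_add[OF rel_scale[OF assms(1), of "v ^ 8"] rel_scale[OF R1, of "v ^ 4"]] R2]
    by (simp add: f_def g_def x v algebra_simps flip: power_add)
  from rel_scale[OF this, of "1 / (v ^ 7 * f)"]
  have "rel v (- (1 / v)) (1 / v ^ 3) (g / (v ^ 3 * f) * v ^ 4) (g / (v ^ 3 * f) / v ^ 4) (g / (v ^ 3 * f))"
    by (simp only: normalize_coefficients(1-3)[OF v(1) f] normalize_coefficients(4-6)[OF v(1) f, of g])
  then show ?thesis using that by blast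
qed

end

section \<open>The choice of the sixth root\<close>

lemma exists_root:
  fixes a :: complex
  shows "\<exists>z. z ^ 6 = a"
proof -
  have "(rcis (root 6 (cmod a)) (Arg a / 6)) ^ 6 = a"
    by (simp add: DeMoivre2 rcis_cmod_Arg)
  then show ?thesis ..
qed

text \<open>The sixth roots of \<open>- w\<close> have three distinct squares, and a polynomial of
  degree at most two in \<open>v\<^sup>2\<close> that vanishes at all of them has zero
  coefficients.\<close>

lemma exists_good_root:
  fixes w p q r :: complex
  assumes "w \<noteq> 0" "\<not> (p = 0 \<and> q = 0 \<and> r = 0)"
  shows "\<exists>v. v \<noteq> 0 \<and> w = - (v ^ 6) \<and> p - v\<^sup>2 * q + v ^ 4 * r \<noteq> 0"
proof (rule ccontr)
  assume *: "\<not> ?thesis"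
  obtain v where v: "v ^ 6 = - w" using exists_root by blast
  \<comment> \<open>A primitive cube root of unity; \<open>v\<close>, \<open>v * z\<close> and
    \<open>v * z\<^sup>2\<close> are sixth roots of \<open>- w\<close> with distinct
    squares.\<close>
  define z where "z = cis (2 * pi / 3)"
  have z3: "z ^ 3 = 1" by (simp add: z_def DeMoivre)
  have z1: "z \<noteq> 1"
  proof
    assume "z = 1"
    then have "Im z = 0" by simp
    then show False by (simp add: z_def sin_120)
  qed
  have "(z - 1) * (z\<^sup>2 + z + 1) = z ^ 3 - 1" by (simp add: algebra_simps power2_eq_square power3_eq_cube)
  also have "\<dots> = 0" using z3 by simp
  finally have "z\<^sup>2 + z + 1 = 0" using z1 by simp
  moreover have "z\<^sup>2 = (z\<^sup>2 + z + 1) - 1 - z" by simp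
  ultimately have z2: "z\<^sup>2 = - 1 - z" by simp
  have v0: "v \<noteq> 0" using v assms(1) by auto
  have root: "p - (v * y)\<^sup>2 * q + (v * y) ^ 4 * r = 0" if "y ^ 3 = 1" for y
  proof -
    have "y ^ 6 = 1" using power_mult[of y 3 2] that by simp
    then have "(v * y) ^ 6 = - w" by (simp add: power_mult_distrib v)
    moreover have "v * y \<noteq> 0" using that v0 by auto
    ultimately show ?thesis using * by (metis minus_equation_iff)
  qed
  define f where "f = v\<^sup>2 * q"
  define g where "g = v ^ 4 * r"
  have 1: "p - f + g = 0"
    using root[of 1] by (simp add: f_def g_def)
  have z4: "z ^ 4 = z" using z3 by (simp add: eval_nat_numeral)
  have 2: "p - z\<^sup>2 * f + z * g = 0"
    using root[OF z3] by (simp add: f_def g_def power_mult_distrib z4 algebra_simps)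
  have z8: "(z\<^sup>2) ^ 4 = z\<^sup>2" using z4 by (metis power_mult mult.commute)
  have "(z\<^sup>2) ^ 3 = 1" using z3 by (metis power_mult mult.commute power_one)
  from root[OF this] have 3: "p - z * f + z\<^sup>2 * g = 0"
    using z4 z8 by (simp add: f_def g_def power_mult_distrib algebra_simps flip: power_mult)
  \<comment> \<open>Summing over the cube roots of unity isolates \<open>p\<close>, since
    \<open>1 + z + z\<^sup>2 = 0\<close>.\<close>
  have "3 * p = (p - f + g) + (p - z\<^sup>2 * f + z * g) + (p - z * f + z\<^sup>2 * g)"
    by (simp add: z2 algebra_simps)
  then have "p = 0" by (simp add: 1 2 3)
  then have "g = f" using 1 by simp
  \<comment> \<open>The factor \<open>1 + 2 * z\<close> is a square root of -3, hence not zero, so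
    \<open>f\<close> must vanish.\<close>
  have "(1 + 2 * z) * f = p - z\<^sup>2 * f + z * g"
    by (simp add: \<open>p = 0\<close> \<open>g = f\<close> z2 algebra_simps)
  then have "(1 + 2 * z)\<^sup>2 * f = 0" by (simp add: 2)
  moreover have "(1 + 2 * z)\<^sup>2 = - 3"
  proof -
    have "(1 + 2 * z)\<^sup>2 = 1 + 4 * z + 4 * z\<^sup>2" by (simp add: power2_eq_square algebra_simps)
    then show ?thesis by (simp add: z2)
  qed
  ultimately have "f = 0" by simp
  then show False
    using \<open>p = 0\<close> \<open>g = f\<close> v0 assms(2) by (simp add: f_def g_def)
qed

theorem theorem1:
  fixes C :: "('o, 'm::ab_group_add, complex, 'z) rib_cat_scheme" (structure)
    and X :: 'o and ev coev \<tau> :: 'm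
  defines "m \<equiv> vertex_m C X coev \<tau>"
    and "\<delta> \<equiv> vertex_delta C X coev \<tau>"
    and "U \<equiv> diagram_U C ev coev"
    and "I \<equiv> diagram_I C X coev \<tau>"
    and "H \<equiv> diagram_H C X coev \<tau>"
    and "\<sigma> \<equiv> neg_crossing C X"
  assumes "trivalent_ribbon_category C X ev coev \<tau>"
    and "\<exists>B. box_basis C X 4 B \<and> finite B \<and> card B \<le> 5"
  shows "\<exists>v \<alpha> b d t :: complex. v \<noteq> 0 \<and>
      ev \<odot> coev = d \<star> \<iota> \<one> \<and>
      m \<odot> coev = 0 \<and>
      m \<odot> \<delta> = b \<star> \<iota> X \<and>
      H \<odot> \<delta> = t \<star> \<delta> \<and>
      \<sigma> \<odot> \<delta> = (- (v ^ 6)) \<star> \<delta> \<and>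
      \<sigma> \<odot> coev = (v ^ 12) \<star> coev \<and>
      vdiff v 5 * b = - \<alpha> * (d + vsum v 8) \<and>
      vsum v 2 * t = b - vdiff v 5 * \<alpha> \<and>
      (v powi (-3)) \<star> (H \<odot> \<sigma>) + v \<star> I - (v powi (-1)) \<star> H
        + \<alpha> \<star> (\<sigma> + (v ^ 4) \<star> U + (v powi (-4)) \<star> \<iota> (X \<boxtimes> X)) = 0"
proof -
  interpret trivalent_diagrams C X ev coev \<tau>
    using assms(7) by (rule trivalent_diagrams.intro)
  obtain d where d: "ap 0 cap cup = d \<star>\<star> ide 0"
    using scalar_box[of 0 "ide 0" "ap 0 cap cup"] box_0 by auto
  obtain b where b: "ap 0 mul spl = b \<star>\<star> ide 1"
    using scalar_strand[of "ap 0 mul spl"] by auto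
  obtain w where w: "ap 0 mul neg = w \<star>\<star> mul"
    using scalar_mul[of "ap 0 mul neg"] by auto
  obtain x where x: "ap 0 cap neg = x \<star>\<star> cap"
    using scalar_cap[of "ap 0 cap neg"] by auto
  obtain l where l: "ap 1 tri (ap 0 cup (ide 2)) = l \<star>\<star> mul"
    using scalar_mul[of "ap 1 tri (ap 0 cup (ide 2))"] by auto
  obtain t where t: "ap 0 rung spl = t \<star>\<star> spl"
    using scalar_spl[of "ap 0 rung spl"] by auto
  interpret trivalent_scalars C X ev coev \<tau> d b w x l
    by unfold_locales (rule d b w x l)+
  obtain p q r p' q' r' where rel: "rel p q r p' q' r'" "\<not> (p = 0 \<and> q = 0 \<and> r = 0)"
    using assms(8) exists_rel exists_tree_rel by metis
  obtain v where v: "v \<noteq> 0" "w = - (v ^ 6)" "p - v\<^sup>2 * q + v ^ 4 * r \<noteq> 0"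
    using exists_good_root[OF w_nonzero rel(2)] by blast
  obtain \<alpha> where \<alpha>: "rel v (- (1 / v)) (1 / v ^ 3) (\<alpha> * v ^ 4) (\<alpha> / v ^ 4) \<alpha>"
    using eigen_rel[OF rel(1) v] by blast
  have x12: "x = v ^ 12" using theta v(2) by simp
  have powi: "v powi (- 3) = 1 / v ^ 3" "v powi (- 4) = 1 / v ^ 4"
    "v powi (- 1) = 1 / v"
    by (simp_all add: power_int_def divide_inverse power_inverse)
  have "vdiff v 5 * b = - \<alpha> * (d + vsum v 8)"
    by (rule scalar_identities(1)[OF v(1)]) (use rel_cup[OF \<alpha>] in \<open>simp only: x12\<close>)
  moreover have "vsum v 2 * t = b - vdiff v 5 * \<alpha>"
    by (rule scalar_identities(2)[OF v(1)]) (use rel_spl[OF \<alpha> t] in \<open>simp only: v(2)\<close>)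
  moreover have "(v powi (-3)) \<star> (H \<odot> \<sigma>) + v \<star> I - (v powi (-1)) \<star> H
        + \<alpha> \<star> (\<sigma> + (v ^ 4) \<star> U + (v powi (-4)) \<star> \<iota> (X \<boxtimes> X)) = 0"
  proof -
    have "H \<odot> \<sigma> = val (ap 0 rung neg)" "I = val (ap 0 spl mul)" "U = val (ap 0 cup cap)"
      using val_cmp[of rung neg] val_cmp[of spl mul] val_cmp[of cup cap]
      by (simp_all add: assms diagram_I_def diagram_U_def)
    moreover have "H = val rung" "\<sigma> = val neg"
      by (simp_all add: assms)
    ultimately show ?thesis
      using \<alpha> unfolding rel_def comb_def powi
      by (simp add: scale_right_distrib algebra_simps)
  qed
  moreover have "ev \<odot> coev = d \<star> \<iota> \<one>" "m \<odot> coev = 0" "m \<odot> \<delta> = b \<star> \<iota> X" "H \<odot> \<delta> = t \<star> \<delta>"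
    "\<sigma> \<odot> \<delta> = (- (v ^ 6)) \<star> \<delta>" "\<sigma> \<odot> coev = (v ^ 12) \<star> coev"
    using val_cmp[of cap cup] val_cmp[of mul cup] val_cmp[of mul spl] val_cmp[of rung spl]
      val_cmp[of neg spl] val_cmp[of neg cup] d b t mul_cup neg_spl neg_cup v(2) x12
    by (simp_all add: assms)
  ultimately show ?thesis using v(1) by blast
qed

end
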